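(* Let $P\subseteq\Phi_{B_n}$ be a signed poset with dual $P^\vee\subseteq\Phi_{C_n}$. Then $$\Psi_P(\mathbf x)=s(K_P^{\mathrm{rt}};\mathbf x),\quad \Psi^\vee_{P^\vee}(\mathbf x)=\tfrac12 s(K_P^{\mathrm{rt}};\mathbf x),\quad \Phi_P(\mathbf x)=s(K_P^{\mathrm{wt}};\mathbf x),\quad \Phi^\vee_{P^\vee}(\mathbf x)=2\,s(K_P^{\mathrm{wt}};\mathbf x),$$ where $s(K;\mathbf x)=\int_K e^{-\langle\mathbf x,u\rangle}\,du$ ($du$ Lebesgue measure).
   Context: $\Phi_{B_n}=\{\pm e_i\pm e_j:i<j\}\cup\{\pm e_i\}$, $\Phi_{C_n}=\{\pm e_i\pm e_j:i<j\}\cup\{\pm2e_i\}$; positive roots $\Phi^+_{B_n}=\{e_i\pm e_j: i<j\}\cup\{e_i\}$. A signed poset is $P\subseteq\Phi_{B_n}$ with $\alpha\in P\Rightarrow-\alpha\notin P$ and $P=\mathbb{R}_{\ge0}P\cap\Phi_{B_n}$; $P^\vee=\{2\alpha/\langle\alpha,\alpha\rangle:\alpha\in P\}$. A signed permutation $w$ is a permutation of $\pm[n]$ with $w(-i)=-w(i)$; it acts linearly on $\mathbb{R}^n$ by $we_i=\mathrm{sgn}(w(i))e_{|w(i)|}$. The linear extensions of $P$ are the signed permutations $w$ with $P\subseteq w\Phi^+_{B_n}$; their set is $\mathcal L(P)$. Let $\alpha_i=e_i-e_{i+1}$ ($1\le i<n$), $\alpha_n=e_n$, $\alpha_n^\vee=2e_n$,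 $\mu_i=e_1+\dots+e_i$, $\mu_n^\vee=\tfrac12(e_1+\dots+e_n)$. Define $\Psi_P(\mathbf x)=\sum_{w\in\mathcal L(P)}\prod_{i=1}^n\langle\mathbf x,w\alpha_i\rangle^{-1}$, $\Psi^\vee_{P^\vee}$ the same with $\alpha_n$ replaced by $\alpha_n^\vee$, $\Phi_P(\mathbf x)=\sum_{w\in\mathcal L(P)}\prod_{i=1}^n\langle\mathbf x,w\mu_i\rangle^{-1}$, and $\Phi^\vee_{P^\vee}$ the same with $\mu_n$ replaced by $\mu_n^\vee$. Root cone $K_P^{\mathrm{rt}}=\mathbb{R}_{\ge0}P$; weight cone $K_P^{\mathrm{wt}}=\{f:\langle f,\alpha\rangle\ge0\ \forall\alpha\in P\}$. For a polyhedral cone $K$ that is pointed and full-dimensional, the integral $s(K;\mathbf x)$ converges for $\mathbf x$ in the interior of the dual cone and extends to a rational function of $\mathbf x$; if $K$ is not pointed or not full-dimensional, $s(K;\mathbf x):=0$. The equalities are of rational functions. *)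

theory Defs
  imports
    "HOL-Analysis.Analysis"
    "HOL-Library.Poly_Mapping"
    "HOL-Computational_Algebra.Fraction_Field"
begin

text \<open>
  Coordinates are indexed by a nonempty finite well-ordered type \<open>'n\<close> in place of
  \<open>{1, \<dots>, n}\<close>, so \<open>n = CARD('n)\<close> and \<open>i < j\<close> is the order of \<open>'n\<close>. The dual space of
  \<open>\<real>\<^sup>n\<close> is identified with \<open>\<real>\<^sup>n\<close> through the standard inner product.
\<close>

abbreviation evec :: "'n::{finite,wellorder} \<Rightarrow> real^'n::_" where
  "evec i \<equiv> axis i 1"


subsection \<open>Roots and signed posets\<close>

definition roots_B :: "(real^'n::{finite,wellorder}) set" where
  "roots_B = {s *\<^sub>R evec i + t *\<^sub>R evec j | s t i j. s \<in> {1, -1} \<and> t \<in> {1, -1} \<and> i < j}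
     \<union> {s *\<^sub>R evec i | s i. s \<in> {1, -1}}"

definition roots_C :: "(real^'n::{finite,wellorder}) set" where
  "roots_C = {s *\<^sub>R evec i + t *\<^sub>R evec j | s t i j. s \<in> {1, -1} \<and> t \<in> {1, -1} \<and> i < j}
     \<union> {(2 * s) *\<^sub>R evec i | s i. s \<in> {1, -1}}"

definition pos_roots_B :: "(real^'n::{finite,wellorder}) set" where
  "pos_roots_B = {evec i + t *\<^sub>R evec j | t i j. t \<in> {1, -1} \<and> i < j} \<union> range evec"

definition root_cone :: "(real^'n::{finite,wellorder}) set \<Rightarrow> (real^'n::_) set" where
  "root_cone P = convex_cone hull P"

definition weight_cone :: "(real^'n::{finite,wellorder}) set \<Rightarrow> (real^'n::_) set" where
  "weight_cone P = {f. \<forall>\<alpha>\<in>P. f \<bullet> \<alpha> \<ge> 0}"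

definition signed_poset :: "(real^'n::{finite,wellorder}) set \<Rightarrow> bool" where
  "signed_poset P \<longleftrightarrow>
     P \<subseteq> roots_B \<and> (\<forall>\<alpha>\<in>P. -\<alpha> \<notin> P) \<and> P = root_cone P \<inter> roots_B"

definition coroot :: "real^'n::{finite,wellorder} \<Rightarrow> real^'n::_" where
  "coroot \<alpha> = (2 / (\<alpha> \<bullet> \<alpha>)) *\<^sub>R \<alpha>"

definition dual_poset :: "(real^'n::{finite,wellorder}) set \<Rightarrow> (real^'n::_) set" where
  "dual_poset P = coroot ` P"

lemma coroot_coroot [simp]: "coroot (coroot \<alpha>) = \<alpha>"
  by (cases "\<alpha> = 0") (auto simp: coroot_def field_simps)

text \<open>Hence a set \<open>P\<close> is recovered from its dual, which justifies indexing
  \<open>\<Psi>\<^sup>\<or>\<close> and \<open>\<Phi>\<^sup>\<or>\<close> below by the dual.\<close>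

lemma coroot_vimage_dual_poset [simp]: "coroot -` dual_poset P = P"
  by (auto simp: dual_poset_def) (metis coroot_coroot)

lemma dual_poset_subset_roots_C:
  fixes P :: "(real^'n::{finite,wellorder}) set"
  assumes "signed_poset P"
  shows "dual_poset P \<subseteq> roots_C"
proof -
  have "coroot \<alpha> \<in> roots_C" if "\<alpha> \<in> roots_B" for \<alpha> :: "real^'n::{finite,wellorder}"
    using that unfolding roots_B_def
  proof
    assume "\<alpha> \<in> {s *\<^sub>R evec i + t *\<^sub>R evec j | s t i j. s \<in> {1, -1} \<and> t \<in> {1, -1} \<and> i < j}"
    then obtain s t :: real and i j
      where st: "s \<in> {1, -1}" "t \<in> {1, -1}" "i < j" "\<alpha> = s *\<^sub>R evec i + t *\<^sub>R evec j" by blast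
    then have "\<alpha> \<bullet> \<alpha> = 2"
      by (auto simp: inner_add_left inner_add_right inner_axis_axis inner_diff_left
          inner_diff_right)
    then have "coroot \<alpha> = \<alpha>" by (simp add: coroot_def)
    then show ?thesis using st unfolding roots_C_def by auto
  next
    assume "\<alpha> \<in> {s *\<^sub>R evec i | s i. s \<in> {1, -1}}"
    then obtain s :: real and i where "s \<in> {1, -1}" "\<alpha> = s *\<^sub>R evec i" by blast
    then have "coroot \<alpha> = (2 * s) *\<^sub>R evec i"
      by (auto simp: coroot_def inner_axis_axis)
    then show ?thesis using \<open>s \<in> {1, -1}\<close> unfolding roots_C_def by blast
  qed
  then show ?thesis using assms by (auto simp: dual_poset_def signed_poset_def)
qed


subsection \<open>Signed permutations and linear extensions\<close>

text \<open>The set \<open>\<plusminus>[n]\<close> is \<open>'n \<times> bool\<close>, with \<open>(i, True)\<close> for \<open>i\<close> and \<open>(i, False)\<close> for \<open>-i\<close>.\<close>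

definition sneg :: "'n \<times> bool \<Rightarrow> 'n \<times> bool" where
  "sneg a = (fst a, \<not> snd a)"

definition ssgn :: "'n \<times> bool \<Rightarrow> real" where
  "ssgn a = (if snd a then 1 else -1)"

definition signed_perm :: "('n \<times> bool \<Rightarrow> 'n \<times> bool) \<Rightarrow> bool" where
  "signed_perm w \<longleftrightarrow> bij w \<and> (\<forall>a. w (sneg a) = sneg (w a))"

definition act :: "('n \<times> bool \<Rightarrow> 'n \<times> bool) \<Rightarrow> real^'n::{finite,wellorder} \<Rightarrow> real^'n::_" where
  "act w x = (\<Sum>i\<in>UNIV. (x $ i) *\<^sub>R (ssgn (w (i, True)) *\<^sub>R evec (fst (w (i, True)))))"

definition linear_extensions ::
    "(real^'n::{finite,wellorder}) set \<Rightarrow> ('n \<times> bool \<Rightarrow> 'n \<times> bool) set" where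
  "linear_extensions P = {w. signed_perm w \<and> P \<subseteq> act w ` pos_roots_B}"

definition last_index :: "'n::{finite,wellorder}" where
  "last_index = Max UNIV"

definition next_index :: "'n::{finite,wellorder} \<Rightarrow> 'n" where
  "next_index i = (LEAST j. i < j)"

definition simple_root :: "'n::{finite,wellorder} \<Rightarrow> real^'n::_" where
  "simple_root i = (if i = last_index then evec i else evec i - evec (next_index i))"

definition simple_coroot :: "'n::{finite,wellorder} \<Rightarrow> real^'n::_" where
  "simple_coroot i = (if i = last_index then 2 *\<^sub>R evec i else evec i - evec (next_index i))"

definition weight :: "'n::{finite,wellorder} \<Rightarrow> real^'n::_" where
  "weight i = (\<Sum>j\<in>{..i}. evec j)"

definition coweight :: "'n::{finite,wellorder} \<Rightarrow> real^'n::_" where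
  "coweight i = (if i = last_index then (1/2) *\<^sub>R (\<Sum>j\<in>UNIV. evec j) else (\<Sum>j\<in>{..i}. evec j))"


subsection \<open>Rational functions in the coordinates of \<open>\<real>\<^sup>n\<close>\<close>

text \<open>Polynomials in the variables \<open>x\<^sub>i\<close>, as finitely supported functions on monomials,
  and their field of fractions.\<close>

type_synonym 'n rpoly = "('n \<Rightarrow>\<^sub>0 nat) \<Rightarrow>\<^sub>0 real"
type_synonym 'n ratfun = "'n rpoly fract"

definition peval :: "'n::{finite,wellorder} rpoly \<Rightarrow> real^'n::_ \<Rightarrow> real" where
  "peval p x = (\<Sum>m\<in>Poly_Mapping.keys p.
     Poly_Mapping.lookup p m * (\<Prod>i\<in>UNIV. (x $ i) ^ Poly_Mapping.lookup m i))"

text \<open>The linear form \<open>\<langle>\<^bold>x, v\<rangle> = \<Sum>\<^sub>i v\<^sub>i x\<^sub>i\<close> as a rational function of \<open>\<^bold>x\<close>.\<close>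

definition lin_form :: "real^'n::{finite,wellorder} \<Rightarrow> 'n ratfun" where
  "lin_form v = Fract (\<Sum>i\<in>UNIV. Poly_Mapping.single (Poly_Mapping.single i 1) (v $ i)) 1"

definition Psi :: "(real^'n::{finite,wellorder}) set \<Rightarrow> 'n ratfun" where
  "Psi P = (\<Sum>w\<in>linear_extensions P. \<Prod>i\<in>UNIV. inverse (lin_form (act w (simple_root i))))"

definition Phi :: "(real^'n::{finite,wellorder}) set \<Rightarrow> 'n ratfun" where
  "Phi P = (\<Sum>w\<in>linear_extensions P. \<Prod>i\<in>UNIV. inverse (lin_form (act w (weight i))))"

text \<open>The argument \<open>Q\<close> of the next two functions is the dual \<open>P\<^sup>\<or>\<close> of a signed poset \<open>P\<close>;
  the sums range over the linear extensions of \<open>P = coroot -` Q\<close>.\<close>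

definition Psi_dual :: "(real^'n::{finite,wellorder}) set \<Rightarrow> 'n ratfun" where
  "Psi_dual Q = (\<Sum>w\<in>linear_extensions (coroot -` Q).
     \<Prod>i\<in>UNIV. inverse (lin_form (act w (simple_coroot i))))"

definition Phi_dual :: "(real^'n::{finite,wellorder}) set \<Rightarrow> 'n ratfun" where
  "Phi_dual Q = (\<Sum>w\<in>linear_extensions (coroot -` Q).
     \<Prod>i\<in>UNIV. inverse (lin_form (act w (coweight i))))"


subsection \<open>The integral \<open>s(K; \<^bold>x)\<close> as a rational function\<close>

definition dual_cone :: "(real^'n::{finite,wellorder}) set \<Rightarrow> (real^'n::_) set" where
  "dual_cone K = {x. \<forall>u\<in>K. x \<bullet> u \<ge> 0}"

definition pointed :: "(real^'n::{finite,wellorder}) set \<Rightarrow> bool" where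
  "pointed K \<longleftrightarrow> K \<inter> uminus ` K \<subseteq> {0}"

definition full_dimensional :: "(real^'n::{finite,wellorder}) set \<Rightarrow> bool" where
  "full_dimensional K \<longleftrightarrow> aff_dim K = int CARD('n)"

text \<open>\<open>R\<close> extends the integral if the integral converges on the whole interior of the dual
  cone and agrees there with \<open>R\<close> wherever \<open>R\<close> is defined, i.e. at every point at which some
  representation of \<open>R\<close> as a fraction has nonzero denominator. For pointed \<open>K\<close> this interior is
  a nonempty open set, so at most one \<open>R\<close> has this property.\<close>

definition extends_integral :: "'n::{finite,wellorder} ratfun \<Rightarrow> (real^'n::_) set \<Rightarrow> bool" where
  "extends_integral R K \<longleftrightarrow> (\<forall>x\<in>interior (dual_cone K).
     set_integrable lebesgue K (\<lambda>u. exp (- (x \<bullet> u))) \<and>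
     (\<forall>p q. R = Fract p q \<and> peval q x \<noteq> 0 \<longrightarrow>
        peval p x / peval q x = (LINT u:K|lebesgue. exp (- (x \<bullet> u)))))"

definition cone_integral :: "(real^'n::{finite,wellorder}) set \<Rightarrow> 'n ratfun" where
  "cone_integral K =
     (if pointed K \<and> full_dimensional K then THE R. extends_integral R K else 0)"

end

theory Submission
  imports Defs
begin

text \<open>
  For a linear extension \<open>w\<close> put \<open>V\<^sub>w(a) = {i. \<langle>a, w\<alpha>\<^sub>i\<rangle> < 0}\<close> and \<open>N\<^sub>w(b) = {i. \<langle>b, w\<mu>\<^sub>i\<rangle> < 0}\<close>, and let
  \<open>F(a, b)\<close> be the sum of \<open>(-1)\<close> to the power \<open>card V\<^sub>w(a)\<close> over those \<open>w \<in> \<L>(P)\<close> with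
  \<open>V\<^sub>w(a) = N\<^sub>w(b)\<close>. The bases \<open>w\<alpha>\<close> and \<open>w\<mu>\<close> are dual and unimodular, so replacing the generators of
  each simplicial cone that are negative on \<open>x\<close> by their opposites gives, for generic \<open>x\<close>,
  \<open>\<Psi>(x) = \<integral> F(x, u) exp(-\<langle>x, u\<rangle>) du\<close> and \<open>\<Phi>(x) = \<integral> F(u, x) exp(-\<langle>x, u\<rangle>) du\<close>.

  If \<open>V\<^sub>w(a) = N\<^sub>w(b)\<close> then every summand of \<open>\<langle>a, b\<rangle> = \<Sum>\<^sub>i \<langle>a, w\<alpha>\<^sub>i\<rangle> \<langle>b, w\<mu>\<^sub>i\<rangle>\<close> is nonnegative; hence
  \<open>F(a, b) = 0\<close> whenever \<open>\<langle>a, b\<rangle> < 0\<close>. Moreover \<open>F(a, b)\<close> is the alternating sum over \<open>T\<close> of the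
  number of \<open>w\<close> with \<open>V\<^sub>w(a) \<subseteq> T \<subseteq> N\<^sub>w(b)\<close>, and this number depends on a generic \<open>a\<close> only through
  its signs on \<open>P\<close>. Thus \<open>a\<close> may be moved as long as these signs do not change: \<open>F(x, \<cdot>)\<close> is the
  indicator function of the root cone by Farkas' lemma, \<open>F(\<cdot>, x)\<close> is that of the weight cone almost
  everywhere, and \<open>F(\<cdot>, x)\<close> vanishes almost everywhere if the weight cone contains a line.
\<close>

subsection \<open>The action of signed permutations\<close>

lemma linear_eq_evec:
  fixes f g :: "real^'n::{finite,wellorder} \<Rightarrow> 'b::real_vector"
  assumes "linear f" "linear g" "\<And>i. f (evec i) = g (evec i)"
  shows "f = g"
  by (rule linear_eq_stdbasis[OF assms(1,2)]) (auto simp: Basis_vec_def assms(3))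

lemma linear_act: "linear (act w)"
  by (rule linearI) (simp_all add: act_def algebra_simps sum.distrib scaleR_sum_right)

lemmas act_add = linear_add[OF linear_act]
lemmas act_diff = linear_diff[OF linear_act]
lemmas act_scaleR = linear_scale[OF linear_act]
lemmas act_sum = linear_sum[OF linear_act]

lemma act_evec: "act w (evec i) = ssgn (w (i, True)) *\<^sub>R evec (fst (w (i, True)))"
proof -
  have "act w (evec i) = (\<Sum>j\<in>UNIV. if j = i then ssgn (w (i, True)) *\<^sub>R evec (fst (w (i, True))) else 0)"
    unfolding act_def by (rule sum.cong) (auto simp: axis_def)
  then show ?thesis by simp
qed

lemma signed_perm_False:
  assumes "signed_perm w"
  shows "w (i, False) = sneg (w (i, True))"
proof -
  have "w (sneg (i, True)) = sneg (w (i, True))"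
    using assms unfolding signed_perm_def by blast
  then show ?thesis by (simp add: sneg_def)
qed

lemma inj_fst_signed_perm:
  assumes "signed_perm w"
  shows "inj (\<lambda>i. fst (w (i, True)))"
proof (rule injI)
  fix i j assume eq: "fst (w (i, True)) = fst (w (j, True))"
  have inj: "inj w" using assms by (simp add: signed_perm_def bij_is_inj)
  have "w (i, True) = w (j, True) \<or> w (i, True) = w (j, False)"
    unfolding signed_perm_False[OF assms] using eq
    by (cases "w (i, True)"; cases "w (j, True)") (auto simp: sneg_def)
  then show "i = j" using inj by (auto dest: injD)
qed

lemma surj_fst_signed_perm:
  fixes w :: "'n::finite \<times> bool \<Rightarrow> 'n \<times> bool"
  assumes "signed_perm w"
  shows "surj (\<lambda>i. fst (w (i, True)))"
  using inj_fst_signed_perm[OF assms] finite_UNIV_inj_surj finite by blast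

lemma ssgn_cases: "ssgn a \<in> {1, -1}"
  by (simp add: ssgn_def)

lemma ssgn_sq [simp]: "ssgn a * ssgn a = 1"
  by (simp add: ssgn_def)

text \<open>Distinct basis vectors go to distinct basis vectors up to sign, and signs square to one,
  so signed permutation matrices are orthogonal.\<close>

lemma inner_act:
  assumes "signed_perm w"
  shows "act w x \<bullet> act w y = x \<bullet> y"
proof -
  let ?f = "\<lambda>i. fst (w (i, True))" and ?s = "\<lambda>i. ssgn (w (i, True))"
  have "act w x \<bullet> act w y
      = (\<Sum>i\<in>UNIV. \<Sum>j\<in>UNIV. x $ i * (y $ j * (?s i * ?s j * (evec (?f i) \<bullet> evec (?f j)))))"
    unfolding act_def inner_sum_left inner_sum_right
    by (subst sum.swap) (simp add: sum_distrib_left mult.assoc inner_commute mult.left_commute)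
  also have "\<dots> = (\<Sum>i\<in>UNIV. \<Sum>j\<in>UNIV. if j = i then x $ i * y $ i else 0)"
    using inj_fst_signed_perm[OF assms]
    by (intro sum.cong refl) (auto simp: inner_axis_axis dest: injD)
  also have "\<dots> = x \<bullet> y" by (simp add: inner_vec_def)
  finally show ?thesis .
qed

lemma orthogonal_transformation_act:
  "signed_perm w \<Longrightarrow> orthogonal_transformation (act w)"
  by (simp add: orthogonal_transformation_def linear_act inner_act)

lemma act_comp:
  assumes "signed_perm w"
  shows "act (w \<circ> s) x = act w (act s x)"
proof -
  have "act (w \<circ> s) = act w \<circ> act s"
  proof (rule linear_eq_evec)
    show "linear (act w \<circ> act s)" by (intro linear_compose linear_act)
    fix i
    obtain j b where s: "s (i, True) = (j, b)" by force
    show "act (w \<circ> s) (evec i) = (act w \<circ> act s) (evec i)"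
      by (cases b) (auto simp: act_evec act_scaleR s ssgn_def sneg_def signed_perm_False[OF assms]
          linear_neg[OF linear_act])
  qed (rule linear_act)
  then show ?thesis by simp
qed

lemma act_inject:
  assumes "signed_perm w" "signed_perm w'" "act w = act w'"
  shows "w = w'"
proof
  have T: "w (i, True) = w' (i, True)" for i
  proof -
    have "ssgn (w (i, True)) *\<^sub>R evec (fst (w (i, True))) =
        ssgn (w' (i, True)) *\<^sub>R evec (fst (w' (i, True)))"
      by (metis act_evec assms(3))
    then have "(ssgn (w (i, True)) *\<^sub>R evec (fst (w (i, True)))) $ fst (w (i, True)) =
        (ssgn (w' (i, True)) *\<^sub>R evec (fst (w' (i, True)))) $ fst (w (i, True))"
      by simp
    then show ?thesis
      by (auto simp: ssgn_def axis_def prod_eq_iff split: if_splits)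
  qed
  fix a show "w a = w' a"
    by (cases a; cases "snd a") (auto simp: T signed_perm_False assms)
qed

subsection \<open>Simple roots and fundamental weights\<close>

lemma le_last_index: "(i::'n::{finite,wellorder}) \<le> last_index"
  by (simp add: last_index_def)

lemma next_index:
  fixes i :: "'n::{finite,wellorder}"
  assumes "i \<noteq> last_index"
  shows "i < next_index i" "next_index i \<le> j \<longleftrightarrow> i < j"
proof -
  have "i < last_index" using assms le_last_index[of i] by simp
  then show *: "i < next_index i" unfolding next_index_def by (rule LeastI)
  show "next_index i \<le> j \<longleftrightarrow> i < j"
    using * Least_le[of "\<lambda>j. i < j" j] unfolding next_index_def by auto
qed

lemma evec_inner_weight: "evec i \<bullet> weight j = (if i \<le> j then 1 else 0)"
  by (simp add: weight_def inner_sum_right inner_axis_axis)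

lemma weight_nth: "weight j $ i = (if i \<le> j then 1 else 0)"
  using evec_inner_weight[of i j] by (simp add: inner_axis')

lemma simple_root_inner_weight:
  "simple_root i \<bullet> weight j = (if i = j then 1 else 0)"
proof (cases "i = last_index")
  case True
  then show ?thesis
    using le_last_index[of j] by (auto simp: simple_root_def evec_inner_weight)
next
  case False
  then show ?thesis
    using next_index(2)[OF False, of j]
    by (auto simp: simple_root_def evec_inner_weight inner_diff_left)
qed

lemma coweight_eq: "coweight i = (if i = last_index then 1/2 else 1) *\<^sub>R weight i"
proof -
  have "{..last_index} = (UNIV::'a set)" by (auto simp: le_last_index)
  then show ?thesis by (simp add: coweight_def weight_def)
qed

lemma simple_coroot_eq: "simple_coroot i = (if i = last_index then 2 else 1) *\<^sub>R simple_root i"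
  by (simp add: simple_coroot_def simple_root_def)

text \<open>Biorthogonality says that two square matrices, with rows \<open>A\<close> and columns
  \<open>B\<close>, are inverse in one order. They are then inverse in the other order too, and this
  resolution of the identity is the expansion.\<close>

lemma dual_basis_expansion:
  fixes A B :: "'n::finite \<Rightarrow> real^'n"
  assumes "\<And>i j. A i \<bullet> B j = (if i = j then 1 else 0)"
  shows "x = (\<Sum>i\<in>UNIV. (x \<bullet> B i) *\<^sub>R A i)" "x \<bullet> y = (\<Sum>i\<in>UNIV. (x \<bullet> B i) * (y \<bullet> A i))"
proof -
  define MA :: "real^'n^'n" where "MA = (\<chi> i. A i)"
  define MB :: "real^'n^'n" where "MB = transpose (\<chi> i. B i)"
  have "MA ** MB = mat 1"
    by (simp add: vec_eq_iff matrix_matrix_mult_def MA_def MB_def transpose_def mat_def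
        assms[unfolded inner_vec_def, simplified])
  then have BA: "MB ** MA = mat 1" by (simp add: matrix_left_right_inverse)
  have e: "(\<Sum>i\<in>UNIV. B i $ k * A i $ l) = (if k = l then 1 else 0)" for k l
    using arg_cong[OF BA, of "\<lambda>M. M $ k $ l"]
    by (simp add: matrix_matrix_mult_def MA_def MB_def transpose_def mat_def)
  show x: "x = (\<Sum>i\<in>UNIV. (x \<bullet> B i) *\<^sub>R A i)" for x
  proof (simp add: vec_eq_iff, intro allI)
    fix l
    have "(\<Sum>i\<in>UNIV. (x \<bullet> B i) * A i $ l) = (\<Sum>i\<in>UNIV. \<Sum>k\<in>UNIV. x $ k * (B i $ k * A i $ l))"
      by (simp add: inner_vec_def sum_distrib_right mult.assoc)
    also have "\<dots> = (\<Sum>k\<in>UNIV. \<Sum>i\<in>UNIV. x $ k * (B i $ k * A i $ l))"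
      by (rule sum.swap)
    also have "\<dots> = (\<Sum>k\<in>UNIV. if k = l then x $ k else 0)"
      by (intro sum.cong refl) (simp add: e flip: sum_distrib_left)
    also have "\<dots> = x $ l" by simp
    finally show "x $ l = (\<Sum>i\<in>UNIV. (x \<bullet> B i) * A i $ l)" by simp
  qed
  show "x \<bullet> y = (\<Sum>i\<in>UNIV. (x \<bullet> B i) * (y \<bullet> A i))"
    by (subst x[of x]) (simp add: inner_sum_left inner_commute[of y])
qed

lemma act_root_inner_weight:
  assumes "signed_perm w"
  shows "act w (simple_root i) \<bullet> act w (weight j) = (if i = j then 1 else 0)"
  by (simp add: inner_act[OF assms] simple_root_inner_weight)

lemma inner_expansion:
  assumes "signed_perm w"
  shows "x \<bullet> y = (\<Sum>i\<in>UNIV. (x \<bullet> act w (simple_root i)) * (y \<bullet> act w (weight i)))"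
  using dual_basis_expansion(2)[of "\<lambda>i. act w (simple_root i)" "\<lambda>i. act w (weight i)" y x]
  by (simp add: act_root_inner_weight[OF assms] inner_commute mult.commute)

text \<open>The fundamental weights form a basis, dual to the simple roots, so their images
  determine the linear map. Thus a chamber is determined by its labelled rays.\<close>

lemma act_weight_inject:
  assumes "signed_perm w" "signed_perm w'" "\<And>i. act w (weight i) = act w' (weight i)"
  shows "w = w'"
proof (rule act_inject[OF assms(1,2)])
  show "act w = act w'"
  proof
    fix x :: "real^'a::{finite,wellorder}"
    have "x = (\<Sum>i\<in>UNIV. (x \<bullet> simple_root i) *\<^sub>R weight i)"
      by (rule dual_basis_expansion(1)) (metis inner_commute simple_root_inner_weight)
    then show "act w x = act w' x"
      by (metis (no_types, lifting) act_scaleR act_sum assms(3) sum.cong)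
  qed
qed

subsection \<open>Roots and linear extensions\<close>

text \<open>Pairing with \<open>weight k\<close> adds up the coordinates up to \<open>k\<close>. For
  a root these partial sums all weakly have the sign of the first nonzero coordinate, which also
  decides positivity.\<close>

lemma root_sign_dichotomy:
  assumes "\<alpha> \<in> roots_B"
  shows "\<alpha> \<in> pos_roots_B \<and> (\<forall>k. \<alpha> \<bullet> weight k \<ge> 0) \<or>
         - \<alpha> \<in> pos_roots_B \<and> (\<forall>k. \<alpha> \<bullet> weight k \<le> 0)"
  using assms unfolding roots_B_def
proof
  assume "\<alpha> \<in> {s *\<^sub>R evec i + t *\<^sub>R evec j | s t i j. s \<in> {1, -1} \<and> t \<in> {1, -1} \<and> i < j}"
  then obtain s t :: real and i j
    where st: "s \<in> {1, -1}" "t \<in> {1, -1}" "i < j" "\<alpha> = s *\<^sub>R evec i + t *\<^sub>R evec j" by blast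
  have in1: "evec i + u *\<^sub>R evec j \<in> pos_roots_B" if "u \<in> {1, -1}" for u :: real
    using that st(3) unfolding pos_roots_B_def by blast
  have ip: "\<alpha> \<bullet> weight k = s * (if i \<le> k then 1 else 0) + t * (if j \<le> k then 1 else 0)" for k
    by (simp add: st(4) inner_add_left evec_inner_weight)
  show ?thesis
  proof (cases "s = 1")
    case True
    have "\<alpha> \<in> pos_roots_B" using in1[of t] st True by simp
    moreover have "\<forall>k. \<alpha> \<bullet> weight k \<ge> 0" using st True unfolding ip by auto
    ultimately show ?thesis by blast
  next
    case False
    then have "s = -1" using st by simp
    have "- \<alpha> = evec i + (- t) *\<^sub>R evec j" using st \<open>s = -1\<close> by simp
    then have "- \<alpha> \<in> pos_roots_B" using in1[of "- t"] st by auto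
    moreover have "\<forall>k. \<alpha> \<bullet> weight k \<le> 0" using st \<open>s = -1\<close> unfolding ip by auto
    ultimately show ?thesis by blast
  qed
next
  assume "\<alpha> \<in> {s *\<^sub>R evec i | s i. s \<in> {1, -1}}"
  then obtain s :: real and i where s: "s = 1 \<or> s = -1" "\<alpha> = s *\<^sub>R evec i" by blast
  have "evec i \<in> pos_roots_B" by (simp add: pos_roots_B_def)
  moreover have "evec i \<bullet> weight k \<ge> 0" for k by (simp add: evec_inner_weight)
  ultimately show ?thesis using s by auto
qed

lemma pos_roots_inner_weight:
  assumes "\<alpha> \<in> pos_roots_B"
  shows "\<alpha> \<bullet> weight k \<ge> 0"
  using assms by (auto simp: pos_roots_B_def inner_add_left inner_diff_left evec_inner_weight)

lemma zero_notin_roots_B: "(0::real^'n::{finite,wellorder}) \<notin> roots_B"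
proof
  assume "(0::real^'n::{finite,wellorder}) \<in> roots_B"
  then show False unfolding roots_B_def
  proof
    assume "(0::real^'n::{finite,wellorder}) \<in> {s *\<^sub>R evec i + t *\<^sub>R evec j | s t i j. s \<in> {1, -1} \<and> t \<in> {1, -1} \<and> i < j}"
    then obtain s t :: real and i j :: 'n
      where st: "s \<in> {1, -1}" "i < j" "0 = s *\<^sub>R evec i + t *\<^sub>R evec j" by blast
    then have "0 = (s *\<^sub>R evec i + t *\<^sub>R evec j) $ i" by (metis zero_index)
    moreover have "(s *\<^sub>R evec i + t *\<^sub>R evec j) $ i = s" using st(2) by (simp add: axis_def)
    ultimately show False using st by auto
  qed (auto simp: axis_eq_0_iff)
qed

lemma finite_roots_B: "finite (roots_B :: (real^'n::{finite,wellorder}) set)"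
proof -
  let ?f = "\<lambda>(s, t, i, j). s *\<^sub>R evec i + t *\<^sub>R (evec j :: real^'n::_)"
  \<comment> \<open>The value 0 for \<open>t\<close> accounts for the short roots.\<close>
  have "\<alpha> \<in> ?f ` ({1, -1} \<times> {0, 1, -1} \<times> UNIV \<times> UNIV)" if "\<alpha> \<in> roots_B" for \<alpha>
    using that unfolding roots_B_def
  proof
    assume "\<alpha> \<in> {s *\<^sub>R evec i + t *\<^sub>R evec j | s t i j. s \<in> {1, -1} \<and> t \<in> {1, -1} \<and> i < j}"
    then obtain s t :: real and i j
      where "s \<in> {1, -1}" "t \<in> {1, -1}" "\<alpha> = s *\<^sub>R evec i + t *\<^sub>R evec j" by blast
    then show ?thesis by (intro image_eqI[of _ _ "(s, t, i, j)"]) auto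
  next
    assume "\<alpha> \<in> {s *\<^sub>R evec i | s i. s \<in> {1, -1}}"
    then obtain s :: real and i where "s \<in> {1, -1}" "\<alpha> = s *\<^sub>R evec i" by blast
    then show ?thesis by (intro image_eqI[of _ _ "(s, 0, i, i)"]) auto
  qed
  then have "roots_B \<subseteq> ?f ` ({1, -1} \<times> {0, 1, -1} \<times> UNIV \<times> UNIV)" by (rule subsetI)
  then show ?thesis by (rule finite_subset) auto
qed

lemma root_B_pairI:
  assumes "s \<in> {1, -1}" "t \<in> {1, -1}" "i \<noteq> j"
  shows "s *\<^sub>R evec i + t *\<^sub>R evec j \<in> roots_B"
proof (cases "i < j")
  case True
  then show ?thesis using assms unfolding roots_B_def by blast
next
  case False
  then have "j < i" using assms by simp
  moreover have "s *\<^sub>R evec i + t *\<^sub>R evec j = t *\<^sub>R evec j + s *\<^sub>R evec i" by simp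
  ultimately show ?thesis using assms unfolding roots_B_def by blast
qed

lemma root_B_singleI: "s \<in> {1, -1} \<Longrightarrow> s *\<^sub>R evec i \<in> roots_B"
  unfolding roots_B_def by blast

lemma simple_root_in_roots_B: "simple_root i \<in> roots_B"
proof (cases "i = last_index")
  case True
  then show ?thesis using root_B_singleI[of 1 i] by (simp add: simple_root_def)
next
  case False
  then have "simple_root i = 1 *\<^sub>R evec i + (-1) *\<^sub>R evec (next_index i)" "i < next_index i"
    by (auto simp: simple_root_def next_index)
  then show ?thesis unfolding roots_B_def by blast
qed

lemma roots_B_uminus:
  assumes "\<alpha> \<in> roots_B"
  shows "- \<alpha> \<in> roots_B"
proof -
  consider (two) s t :: real and i j
      where "s \<in> {1, -1}" "t \<in> {1, -1}" "i < j" "\<alpha> = s *\<^sub>R evec i + t *\<^sub>R evec j"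
    | (one) s :: real and i where "s \<in> {1, -1}" "\<alpha> = s *\<^sub>R evec i"
    using assms unfolding roots_B_def by blast
  then show ?thesis
  proof cases
    case two
    then have "- \<alpha> = (- s) *\<^sub>R evec i + (- t) *\<^sub>R evec j" "- s \<in> {1, -1}" "- t \<in> {1, -1}" by auto
    then show ?thesis using two(3) root_B_pairI[of "- s" "- t" i j] by simp
  next
    case one
    then have "- \<alpha> = (- s) *\<^sub>R evec i" "- s \<in> {1, -1}" by auto
    then show ?thesis using root_B_singleI[of "- s" i] by simp
  qed
qed

lemma roots_B_preimage_act:
  assumes w: "signed_perm w" and "\<alpha> \<in> roots_B"
  obtains \<beta> where "\<beta> \<in> roots_B" "\<alpha> = act w \<beta>"
proof -
  have pre: "\<exists>s j. s \<in> {1, -1} \<and> evec i = act w (s *\<^sub>R evec j) \<and> i = fst (w (j, True))"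
    for i :: 'a
  proof -
    obtain j where j: "i = fst (w (j, True))" using surj_fst_signed_perm[OF w] by (auto simp: surj_def)
    then have "evec i = act w (ssgn (w (j, True)) *\<^sub>R evec j)"
      by (simp add: act_scaleR act_evec)
    then show ?thesis using j ssgn_cases[of "w (j, True)"]
      by (intro exI[of _ "ssgn (w (j, True))"] exI[of _ j]) simp
  qed
  show thesis using assms(2) unfolding roots_B_def
  proof
    assume "\<alpha> \<in> {s *\<^sub>R evec i + t *\<^sub>R evec j | s t i j. s \<in> {1, -1} \<and> t \<in> {1, -1} \<and> i < j}"
    then obtain s t :: real and i j
      where st: "s \<in> {1, -1}" "t \<in> {1, -1}" "i < j" "\<alpha> = s *\<^sub>R evec i + t *\<^sub>R evec j" by blast
    obtain s' i' where i': "s' \<in> {1, -1}" "evec i = act w (s' *\<^sub>R evec i')" "i = fst (w (i', True))"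
      using pre by blast
    obtain t' j' where j': "t' \<in> {1, -1}" "evec j = act w (t' *\<^sub>R evec j')" "j = fst (w (j', True))"
      using pre by blast
    have "i' \<noteq> j'" using i' j' st by auto
    moreover have "s * s' \<in> {1, -1}" "t * t' \<in> {1, -1}" using st i' j' by auto
    ultimately have "(s * s') *\<^sub>R evec i' + (t * t') *\<^sub>R evec j' \<in> roots_B" by (intro root_B_pairI)
    then show thesis
      by (rule that) (simp add: st(4) i'(2) j'(2) act_add act_scaleR)
  next
    assume "\<alpha> \<in> {s *\<^sub>R evec i | s i. s \<in> {1, -1}}"
    then obtain s :: real and i where s: "s \<in> {1, -1}" "\<alpha> = s *\<^sub>R evec i" by blast
    obtain s' i' where i': "s' \<in> {1, -1}" "evec i = act w (s' *\<^sub>R evec i')"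
      using pre by blast
    have "s * s' \<in> {1, -1}" using s i' by auto
    then have "(s * s') *\<^sub>R evec i' \<in> roots_B" by (rule root_B_singleI)
    then show thesis by (rule that) (simp add: s(2) i'(2) act_scaleR)
  qed
qed

text \<open>The form suits proofs by contradiction: a root that violates the condition for a linear
  extension is nonpositive on every ray of the chamber of \<open>w\<close>.\<close>

lemma act_root_sign_dichotomy:
  assumes w: "signed_perm w" and "\<alpha> \<in> roots_B"
  shows "\<alpha> \<in> act w ` pos_roots_B \<or> (\<forall>k. \<alpha> \<bullet> act w (weight k) \<le> 0)"
proof -
  obtain \<beta> where \<beta>: "\<beta> \<in> roots_B" "\<alpha> = act w \<beta>" by (rule roots_B_preimage_act[OF assms])
  then show ?thesis using root_sign_dichotomy[OF \<beta>(1)] by (auto simp: inner_act[OF w])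
qed

lemma linear_extension_inner_weight:
  assumes "w \<in> linear_extensions P" "\<alpha> \<in> P"
  shows "\<alpha> \<bullet> act w (weight k) \<ge> 0"
proof -
  have w: "signed_perm w" and "\<alpha> \<in> act w ` pos_roots_B"
    using assms unfolding linear_extensions_def by auto
  then show ?thesis by (auto simp: inner_act pos_roots_inner_weight)
qed

subsection \<open>Chambers around a face\<close>

text \<open>The reflection in the wall orthogonal to \<open>simple_root i\<close>, written on signed
  indices. Composing it on the right of \<open>w\<close> passes to the neighbouring chamber across
  wall \<open>i\<close>.\<close>

definition simple_reflection :: "'n::{finite,wellorder} \<Rightarrow> 'n \<times> bool \<Rightarrow> 'n \<times> bool" where
  "simple_reflection i a =
     (if i = last_index then (fst a, if fst a = i then \<not> snd a else snd a)
      else (if fst a = i then next_index i else if fst a = next_index i then i else fst a, snd a))"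

lemma signed_perm_comp: "signed_perm w \<Longrightarrow> signed_perm v \<Longrightarrow> signed_perm (w \<circ> v)"
  by (simp add: signed_perm_def bij_comp del: split_paired_All)

lemma signed_perm_simple_reflection: "signed_perm (simple_reflection i)"
proof -
  have "simple_reflection i (simple_reflection i a) = a" for a
    by (cases a) (auto simp: simple_reflection_def)
  then have "bij (simple_reflection i)" by (intro o_bij[of "simple_reflection i"]) auto
  then show ?thesis by (auto simp: signed_perm_def simple_reflection_def sneg_def)
qed

lemma act_simple_reflection:
  \<comment> \<open>The factor is 2 divided by the squared length of the root: the last simple root
    has squared length 1, the others have squared length 2.\<close>
  "act (simple_reflection i) x
     = x - (if i = last_index then 2 else 1) *\<^sub>R (x \<bullet> simple_root i) *\<^sub>R simple_root i"
proof -
  have "act (simple_reflection i)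
      = (\<lambda>x. x - (if i = last_index then 2 else 1) *\<^sub>R (x \<bullet> simple_root i) *\<^sub>R simple_root i)"
  proof (rule linear_eq_evec)
    fix k
    have "i \<noteq> last_index \<Longrightarrow> i \<noteq> next_index i" using next_index(1)[of i] by auto
    then show "act (simple_reflection i) (evec k) = evec k
        - (if i = last_index then 2 else 1) *\<^sub>R (evec k \<bullet> simple_root i) *\<^sub>R simple_root i"
      by (auto simp: act_evec simple_reflection_def ssgn_def simple_root_def inner_axis_axis
          inner_diff_right scaleR_2)
  next
    show "linear (\<lambda>x. x - (if i = last_index then 2 else 1) *\<^sub>R (x \<bullet> simple_root i) *\<^sub>R simple_root i)"
      by (rule linearI) (simp_all add: inner_add_left algebra_simps)
  qed (rule linear_act)
  then show ?thesis by simp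
qed

text \<open>Among the finitely many chambers with the prescribed rays in \<open>T\<close>, take one
  that maximises the pairing of \<open>a\<close> with the sum of its rays. Crossing a wall
  \<open>i\<close> outside \<open>T\<close> moves only ray \<open>i\<close>, so the neighbour is
  still a candidate, and maximality forces \<open>a\<close> onto the right side of that
  wall.\<close>

lemma exists_chamber_on_face:
  assumes "signed_perm w0"
  obtains w where "signed_perm w" "\<And>i. i \<in> T \<Longrightarrow> act w (weight i) = act w0 (weight i)"
    "\<And>i. i \<notin> T \<Longrightarrow> a \<bullet> act w (simple_root i) \<ge> 0"
proof -
  define S where "S = {w. signed_perm w \<and> (\<forall>i\<in>T. act w (weight i) = act w0 (weight i))}"
  define f where "f w = (\<Sum>j\<in>UNIV. a \<bullet> act w (weight j))" for w
  have "finite S" "S \<noteq> {}" using assms by (auto simp: S_def)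
  then have "Max (f ` S) \<in> f ` S" by (intro Max_in) auto
  then obtain w where w: "w \<in> S" and "f w = Max (f ` S)" by auto
  then have max: "f v \<le> f w" if "v \<in> S" for v using that \<open>finite S\<close> by simp
  have sw: "signed_perm w" using w by (simp add: S_def)
  have "a \<bullet> act w (simple_root i) \<ge> 0" if "i \<notin> T" for i
  proof -
    define v where "v = w \<circ> simple_reflection i"
    define c :: real where "c = (if i = last_index then 2 else 1)"
    \<comment> \<open>By duality, only the weight with index \<open>i\<close> is moved by the
      reflection.\<close>
    have v: "act v (weight j) = act w (weight j) - (if i = j then c else 0) *\<^sub>R act w (simple_root i)" for j
      by (simp add: v_def act_comp[OF sw] act_simple_reflection c_def act_diff act_scaleR
          inner_commute[of "weight j"] simple_root_inner_weight)
    have "v \<in> S"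
      using w that by (auto simp: S_def v) (simp add: v_def signed_perm_comp signed_perm_simple_reflection)
    then have "f v \<le> f w" by (rule max)
    also have "f v = f w - c * (a \<bullet> act w (simple_root i))"
    proof -
      have "f v = (\<Sum>j\<in>UNIV. a \<bullet> act w (weight j) - (if i = j then c * (a \<bullet> act w (simple_root i)) else 0))"
        unfolding f_def by (intro sum.cong refl) (simp add: v inner_diff_right)
      then show ?thesis by (simp add: sum_subtractf f_def)
    qed
    finally show ?thesis by (simp add: c_def zero_le_mult_iff split: if_splits)
  qed
  then show thesis using that[of w] w by (auto simp: S_def)
qed

section \<open>Uniqueness of the chamber around a face\<close>

lemma act_nth:
  assumes "signed_perm w"
  shows "act w x $ fst (w (l, True)) = ssgn (w (l, True)) * x $ l"
proof -
  have "act w x \<bullet> act w (evec l) = x $ l"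
    by (simp add: inner_act[OF assms] inner_axis)
  then have "ssgn (w (l, True)) * (act w x $ fst (w (l, True))) = x $ l"
    by (simp add: act_evec inner_axis)
  then show ?thesis by (metis mult.assoc mult_1 ssgn_sq)
qed

lemma act_weight_nth:
  assumes "signed_perm w"
  shows "act w (weight j) $ k \<in> {-1, 0, 1}"
proof -
  obtain l where "k = fst (w (l, True))"
    using surj_fst_signed_perm[OF assms] by (auto simp: surj_def)
  then show ?thesis by (simp add: act_nth[OF assms] weight_nth ssgn_def)
qed

text \<open>The image of a weight has coordinates in {-1, 0, 1}, and as many nonzero ones as the
  weight itself. The pairing is therefore at most the smaller of the two supports, and since the
  supports of the weights are nested, this is the pairing of the weights.\<close>

lemma inner_act_weights_le:
  assumes w: "signed_perm w" and w': "signed_perm w'"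
  shows "act w (weight j) \<bullet> act w' (weight i) \<le> weight j \<bullet> weight i"
proof -
  have *: "act u (weight k) \<bullet> act v (weight l) \<le> weight k \<bullet> weight k"
    if "signed_perm u" "signed_perm v" for u v :: "'a \<times> bool \<Rightarrow> 'a \<times> bool" and k l
  proof -
    have "act u (weight k) \<bullet> act v (weight l) \<le> act u (weight k) \<bullet> act u (weight k)"
      unfolding inner_vec_def
    proof (rule sum_mono)
      fix m
      show "act u (weight k) $ m \<bullet> act v (weight l) $ m \<le> act u (weight k) $ m \<bullet> act u (weight k) $ m"
        using act_weight_nth[OF that(1), of k m] act_weight_nth[OF that(2), of l m] by auto
    qed
    then show ?thesis by (simp add: inner_act[OF that(1)])
  qed
  have **: "weight k \<bullet> weight k = weight k \<bullet> weight l" if "k \<le> l" for k l :: 'a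
    unfolding inner_vec_def using that by (intro sum.cong refl) (auto simp: weight_nth)
  show ?thesis
  proof (cases "j \<le> i")
    case True
    then show ?thesis using *[OF w w', of j i] **[of j i] by simp
  next
    case False
    then show ?thesis using *[OF w' w, of i j] **[of i j] by (simp add: inner_commute)
  qed
qed

text \<open>Expand the difference of the pairings of \<open>a\<close> with ray \<open>i\<close> of
  the two chambers in the coordinates of one chamber. Terms with index in \<open>T\<close> vanish,
  and the others are nonnegative by \<open>inner_act_weights_le\<close>. Exchanging the chambers
  gives the opposite inequality, so every term is zero, and strict positivity off \<open>T\<close>
  forces equality in \<open>inner_act_weights_le\<close>.\<close>

lemma chamber_on_face_unique:
  assumes w: "signed_perm w" and w': "signed_perm w'"
    and T: "\<And>i. i \<in> T \<Longrightarrow> act w (weight i) = act w' (weight i)"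
    and pos: "\<And>i. i \<notin> T \<Longrightarrow> a \<bullet> act w (simple_root i) > 0"
    and pos': "\<And>i. i \<notin> T \<Longrightarrow> a \<bullet> act w' (simple_root i) > 0"
  shows "w = w'"
proof (rule act_weight_inject[OF w w'])
  fix i
  have diff: "a \<bullet> act u (weight i) - a \<bullet> act v (weight i) = (\<Sum>j\<in>UNIV. (a \<bullet> act u (simple_root j)) *
      (weight j \<bullet> weight i - act u (weight j) \<bullet> act v (weight i)))"
    if u: "signed_perm u" for u v
    unfolding inner_expansion[OF u, of a "act u (weight i)"] inner_expansion[OF u, of a "act v (weight i)"]
    by (simp add: inner_act[OF u] inner_commute algebra_simps flip: sum_subtractf)
  have nonneg: "(a \<bullet> act u (simple_root j)) * (weight j \<bullet> weight i - act u (weight j) \<bullet> act v (weight i)) \<ge> 0"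
    if u: "signed_perm u" and v: "signed_perm v"
      and T: "\<And>i. i \<in> T \<Longrightarrow> act u (weight i) = act v (weight i)"
      and pos: "\<And>i. i \<notin> T \<Longrightarrow> a \<bullet> act u (simple_root i) > 0" for u v j
  proof (cases "j \<in> T")
    case True
    then show ?thesis by (simp add: T inner_act[OF v])
  next
    case False
    then show ?thesis using pos[of j] inner_act_weights_le[OF u v, of j i] by simp
  qed
  have "a \<bullet> act w' (weight i) - a \<bullet> act w (weight i) \<ge> 0"
    unfolding diff[OF w'] by (intro sum_nonneg nonneg w w' pos') (simp add: T)
  moreover have "a \<bullet> act w (weight i) - a \<bullet> act w' (weight i) \<ge> 0"
    unfolding diff[OF w] by (intro sum_nonneg nonneg w w' pos T)
  ultimately have "a \<bullet> act w (weight i) - a \<bullet> act w' (weight i) = 0" by simp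
  then have "(\<Sum>j\<in>UNIV. (a \<bullet> act w (simple_root j)) *
      (weight j \<bullet> weight i - act w (weight j) \<bullet> act w' (weight i))) = 0"
    by (simp add: diff[OF w])
  moreover have "\<And>j. (a \<bullet> act w (simple_root j)) *
      (weight j \<bullet> weight i - act w (weight j) \<bullet> act w' (weight i)) \<ge> 0"
    by (intro nonneg w w' T pos)
  ultimately have z: "(a \<bullet> act w (simple_root j)) *
      (weight j \<bullet> weight i - act w (weight j) \<bullet> act w' (weight i)) = 0" for j
    by (simp add: sum_nonneg_eq_0_iff)
  have "act w (weight j) \<bullet> act w' (weight i) = weight j \<bullet> weight i" for j
  proof (cases "j \<in> T")
    case True
    then show ?thesis by (simp add: T inner_act[OF w'])
  next
    case False
    then show ?thesis using z[of j] pos[of j] by simp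
  qed
  \<comment> \<open>The difference of the two rays is orthogonal to a basis, hence zero.\<close>
  then have 0: "(act w (weight i) - act w' (weight i)) \<bullet> act w (weight j) = 0" for j
    by (subst inner_commute) (simp add: inner_diff_right inner_act[OF w])
  let ?d = "act w (weight i) - act w' (weight i)"
  have "?d \<bullet> ?d = 0" by (subst inner_expansion[OF w]) (simp add: 0)
  then show "act w (weight i) = act w' (weight i)" by simp
qed

subsection \<open>The signed count of linear extensions\<close>

definition neg_roots :: "('n \<times> bool \<Rightarrow> 'n \<times> bool) \<Rightarrow> real^'n::{finite,wellorder} \<Rightarrow> 'n set" where
  "neg_roots w a = {i. a \<bullet> act w (simple_root i) < 0}"

definition neg_weights :: "('n \<times> bool \<Rightarrow> 'n \<times> bool) \<Rightarrow> real^'n::{finite,wellorder} \<Rightarrow> 'n set" where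
  "neg_weights w b = {i. b \<bullet> act w (weight i) < 0}"

text \<open>This is F(a, b) of the overview, with \<open>neg_roots\<close> for V and
  \<open>neg_weights\<close> for N.\<close>

definition signed_count :: "(real^'n::{finite,wellorder}) set \<Rightarrow> real^'n::_ \<Rightarrow> real^'n::_ \<Rightarrow> real" where
  "signed_count P a b = (\<Sum>w\<in>linear_extensions P.
     if neg_roots w a = neg_weights w b then (-1) ^ card (neg_roots w a) else 0)"

definition regular :: "real^'n::{finite,wellorder} \<Rightarrow> bool" where
  "regular a \<longleftrightarrow> (\<forall>\<alpha>\<in>roots_B. a \<bullet> \<alpha> \<noteq> 0)"

lemma roots_B_act:
  assumes w: "signed_perm w" and "\<alpha> \<in> roots_B"
  shows "act w \<alpha> \<in> roots_B"
proof -
  consider (two) s t :: real and i j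
      where "s \<in> {1, -1}" "t \<in> {1, -1}" "i < j" "\<alpha> = s *\<^sub>R evec i + t *\<^sub>R evec j"
    | (one) s :: real and i where "s \<in> {1, -1}" "\<alpha> = s *\<^sub>R evec i"
    using assms(2) unfolding roots_B_def by blast
  then show ?thesis
  proof cases
    case two
    let ?f = "\<lambda>i. fst (w (i, True))" and ?s = "\<lambda>i. ssgn (w (i, True))"
    have "act w \<alpha> = (s * ?s i) *\<^sub>R evec (?f i) + (t * ?s j) *\<^sub>R evec (?f j)"
      by (simp add: two(4) act_add act_scaleR act_evec)
    moreover have "?f i \<noteq> ?f j" using inj_fst_signed_perm[OF w] two(3) by (auto dest: injD)
    moreover have "s * ?s i \<in> {1, -1}" "t * ?s j \<in> {1, -1}" using two(1,2) by (auto simp: ssgn_def)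
    ultimately show ?thesis by (metis root_B_pairI)
  next
    case one
    have "act w \<alpha> = (s * ssgn (w (i, True))) *\<^sub>R evec (fst (w (i, True)))"
      by (simp add: one(2) act_scaleR act_evec)
    moreover have "s * ssgn (w (i, True)) \<in> {1, -1}" using one(1) by (auto simp: ssgn_def)
    ultimately show ?thesis by (metis root_B_singleI)
  qed
qed

lemma regular_act_simple_root:
  "regular a \<Longrightarrow> signed_perm w \<Longrightarrow> a \<bullet> act w (simple_root i) \<noteq> 0"
  using roots_B_act simple_root_in_roots_B by (auto simp: regular_def)

lemma linear_extension_signed_perm: "w \<in> linear_extensions P \<Longrightarrow> signed_perm w"
  by (simp add: linear_extensions_def)

text \<open>Suppose that a root of \<open>P\<close> is negative for \<open>w'\<close>. It is
  nonnegative on the rays of \<open>w\<close> and nonpositive on those of \<open>w'\<close>, so it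
  vanishes on the common rays, those in \<open>T\<close>. Only walls off \<open>T\<close> remain in
  the expansions; there \<open>a\<close> and \<open>a'\<close> are on the positive sides, so the
  root is nonnegative on \<open>a\<close> and nonpositive on \<open>a'\<close>. As \<open>a\<close>
  is regular, this contradicts the equal signs.\<close>

lemma linear_extension_transfer:
  assumes P: "P \<subseteq> roots_B" and a: "regular a" and a': "regular a'"
    and signs: "\<And>\<alpha>. \<alpha> \<in> P \<Longrightarrow> 0 < a \<bullet> \<alpha> \<longleftrightarrow> 0 < a' \<bullet> \<alpha>"
    and w: "w \<in> linear_extensions P" "\<And>i. i \<notin> T \<Longrightarrow> a \<bullet> act w (simple_root i) \<ge> 0"
    and w': "signed_perm w'" "\<And>i. i \<notin> T \<Longrightarrow> a' \<bullet> act w' (simple_root i) \<ge> 0"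
    and T: "\<And>i. i \<in> T \<Longrightarrow> act w (weight i) = act w' (weight i)"
  shows "w' \<in> linear_extensions P"
proof -
  have sw: "signed_perm w" using w(1) by (rule linear_extension_signed_perm)
  have "\<alpha> \<in> act w' ` pos_roots_B" if \<alpha>: "\<alpha> \<in> P" for \<alpha>
  proof (rule ccontr)
    assume "\<alpha> \<notin> act w' ` pos_roots_B"
    then have neg: "\<alpha> \<bullet> act w' (weight k) \<le> 0" for k
      using act_root_sign_dichotomy[OF w'(1), of \<alpha>] \<alpha> P by blast
    have pos: "\<alpha> \<bullet> act w (weight k) \<ge> 0" for k by (rule linear_extension_inner_weight[OF w(1) \<alpha>])
    have zero: "\<alpha> \<bullet> act w' (weight k) = 0" if "k \<in> T" for k
      using pos[of k] neg[of k] T[OF that] by simp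
    have "a \<bullet> \<alpha> \<ge> 0"
      unfolding inner_expansion[OF sw, of a \<alpha>]
    proof (intro sum_nonneg)
      fix i show "(a \<bullet> act w (simple_root i)) * (\<alpha> \<bullet> act w (weight i)) \<ge> 0"
        using zero[of i] T[of i] w(2)[of i] pos[of i] by (cases "i \<in> T") auto
    qed
    moreover have "a' \<bullet> \<alpha> \<le> 0"
      unfolding inner_expansion[OF w'(1), of a' \<alpha>]
    proof (intro sum_nonpos)
      fix i show "(a' \<bullet> act w' (simple_root i)) * (\<alpha> \<bullet> act w' (weight i)) \<le> 0"
        using zero[of i] w'(2)[of i] neg[of i] by (cases "i \<in> T") (auto simp: mult_nonneg_nonpos)
    qed
    moreover have "a \<bullet> \<alpha> \<noteq> 0" using a \<alpha> P by (auto simp: regular_def)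
    ultimately show False using signs[OF \<alpha>] by simp
  qed
  then show ?thesis using w'(1) by (auto simp: linear_extensions_def)
qed

text \<open>The two inclusions separate the roles of \<open>a\<close> and \<open>b\<close>: the one
  with \<open>b\<close> concerns only the face spanned by the rays with index in \<open>T\<close>,
  and the one with \<open>a\<close> selects, among the chambers around this face, one on the side of
  \<open>a\<close>.\<close>

definition face_extensions ::
    "(real^'n::{finite,wellorder}) set \<Rightarrow> 'n set \<Rightarrow> real^'n::_ \<Rightarrow> real^'n::_ \<Rightarrow> ('n \<times> bool \<Rightarrow> 'n \<times> bool) set" where
  "face_extensions P T a b = {w \<in> linear_extensions P. neg_roots w a \<subseteq> T \<and> T \<subseteq> neg_weights w b}"

text \<open>Turn each chamber around its \<open>T\<close>-face until it lies on the side of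
  \<open>a'\<close>. The result is again a linear extension by transfer, and the condition on
  \<open>b\<close> sees only the rays that were kept. The map is injective because only one chamber
  around a given face is on the side of the regular vector \<open>a\<close>. Exchanging
  \<open>a\<close> and \<open>a'\<close> then yields equality.\<close>

lemma card_face_extensions_le:
  assumes P: "P \<subseteq> roots_B" and a: "regular a" and a': "regular a'"
    and signs: "\<And>\<alpha>. \<alpha> \<in> P \<Longrightarrow> 0 < a \<bullet> \<alpha> \<longleftrightarrow> 0 < a' \<bullet> \<alpha>"
  shows "card (face_extensions P T a b) \<le> card (face_extensions P T a' b)"
proof -
  have "\<exists>w'\<in>face_extensions P T a' b. \<forall>i\<in>T. act w' (weight i) = act w (weight i)"
    if "w \<in> face_extensions P T a b" for w
  proof -
    have w: "w \<in> linear_extensions P" "neg_roots w a \<subseteq> T" "T \<subseteq> neg_weights w b"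
      using that by (auto simp: face_extensions_def)
    obtain w' where w': "signed_perm w'" "\<And>i. i \<in> T \<Longrightarrow> act w' (weight i) = act w (weight i)"
      "\<And>i. i \<notin> T \<Longrightarrow> a' \<bullet> act w' (simple_root i) \<ge> 0"
      using exists_chamber_on_face[OF linear_extension_signed_perm[OF w(1)], of T a'] by blast
    have "w' \<in> linear_extensions P"
    proof (rule linear_extension_transfer[OF P a a' signs w(1) _ w'(1) w'(3)])
      show "a \<bullet> act w (simple_root i) \<ge> 0" if "i \<notin> T" for i
      proof -
        have "i \<notin> neg_roots w a" using that w(2) by blast
        then show ?thesis by (simp add: neg_roots_def)
      qed
    qed (use w'(2) in auto)
    moreover have "neg_roots w' a' \<subseteq> T" using w'(3) by (force simp: neg_roots_def)
    moreover have "T \<subseteq> neg_weights w' b" using w(3) w'(2) by (auto simp: neg_weights_def)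
    ultimately show ?thesis using w'(2) by (auto simp: face_extensions_def)
  qed
  then obtain \<phi> where \<phi>: "\<And>w. w \<in> face_extensions P T a b \<Longrightarrow> \<phi> w \<in> face_extensions P T a' b"
    "\<And>w i. w \<in> face_extensions P T a b \<Longrightarrow> i \<in> T \<Longrightarrow> act (\<phi> w) (weight i) = act w (weight i)"
    by metis
  show ?thesis
  proof (rule card_inj_on_le[of \<phi>])
    show "inj_on \<phi> (face_extensions P T a b)"
    proof (rule inj_onI)
      fix u v assume uv: "u \<in> face_extensions P T a b" "v \<in> face_extensions P T a b" "\<phi> u = \<phi> v"
      have s: "signed_perm u" "signed_perm v"
        using uv by (auto simp: face_extensions_def linear_extension_signed_perm)
      have pos: "a \<bullet> act w (simple_root i) > 0" if "w \<in> face_extensions P T a b" "i \<notin> T" for w i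
      proof -
        have "signed_perm w" "i \<notin> neg_roots w a"
          using that by (auto simp: face_extensions_def linear_extension_signed_perm)
        then show ?thesis using regular_act_simple_root[OF a, of w i] by (simp add: neg_roots_def)
      qed
      show "u = v"
        by (rule chamber_on_face_unique[OF s, of T a]) (use uv \<phi>(2) pos in metis)+
    qed
    show "\<phi> ` face_extensions P T a b \<subseteq> face_extensions P T a' b" using \<phi>(1) by auto
  qed simp
qed

text \<open>This replaces the condition \<open>V = N\<close> by an alternating sum of conditions
  that bound \<open>V\<close> and \<open>N\<close> separately. A Boolean interval with more than one
  element has equally many even and odd members.\<close>

lemma sum_sign_between:
  fixes V N :: "'a::finite set"
  shows "(\<Sum>T | V \<subseteq> T \<and> T \<subseteq> N. (-1) ^ card T) = (if V = N then (-1) ^ card V else (0::real))"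
proof (cases "V \<subset> N")
  case True
  then have "(\<Sum>T\<in>{T. V \<subseteq> T \<and> T \<subseteq> N}. (-1) ^ card T) = (0::real)"
    by (intro sum_alternating_cancels) (use card_subsupersets_even_odd[of N V] in \<open>simp_all add: conj_ac\<close>)
  then show ?thesis using True by auto
next
  case False
  then have "{T. V \<subseteq> T \<and> T \<subseteq> N} = (if V = N then {V} else {})" by auto
  then show ?thesis by simp
qed

lemma signed_count_eq_sum_faces:
  "signed_count P a b = (\<Sum>T\<in>UNIV. (-1) ^ card T * real (card (face_extensions P T a b)))"
proof -
  have "signed_count P a b = (\<Sum>w\<in>linear_extensions P.
      \<Sum>T\<in>UNIV. if neg_roots w a \<subseteq> T \<and> T \<subseteq> neg_weights w b then (-1) ^ card T else 0)"
    unfolding signed_count_def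
    by (intro sum.cong refl) (simp add: sum_sign_between flip: sum.inter_filter)
  also have "\<dots> = (\<Sum>T\<in>UNIV. \<Sum>w\<in>linear_extensions P.
      if neg_roots w a \<subseteq> T \<and> T \<subseteq> neg_weights w b then (-1) ^ card T else 0)"
    by (rule sum.swap)
  also have "\<dots> = (\<Sum>T\<in>UNIV. (-1) ^ card T * real (card (face_extensions P T a b)))"
    by (intro sum.cong refl) (simp add: face_extensions_def mult.commute flip: sum.inter_filter)
  finally show ?thesis .
qed

lemma signed_count_cong:
  assumes "P \<subseteq> roots_B" "regular a" "regular a'"
    and "\<And>\<alpha>. \<alpha> \<in> P \<Longrightarrow> 0 < a \<bullet> \<alpha> \<longleftrightarrow> 0 < a' \<bullet> \<alpha>"
  shows "signed_count P a b = signed_count P a' b"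
proof -
  have "card (face_extensions P T a b) = card (face_extensions P T a' b)" for T
    using assms by (intro antisym card_face_extensions_le) auto
  then show ?thesis by (simp add: signed_count_eq_sum_faces)
qed

lemma signed_count_eq_0:
  assumes "a \<bullet> b < 0"
  shows "signed_count P a b = 0"
proof -
  have "neg_roots w a \<noteq> neg_weights w b" if "w \<in> linear_extensions P" for w
  proof
    assume eq: "neg_roots w a = neg_weights w b"
    have "a \<bullet> b \<ge> 0"
      unfolding inner_expansion[OF linear_extension_signed_perm[OF that], of a b]
    proof (intro sum_nonneg)
      fix i
      have "a \<bullet> act w (simple_root i) < 0 \<longleftrightarrow> b \<bullet> act w (weight i) < 0"
        using eq[THEN eqset_imp_iff, of i] by (simp add: neg_roots_def neg_weights_def)
      then show "(a \<bullet> act w (simple_root i)) * (b \<bullet> act w (weight i)) \<ge> 0"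
        unfolding zero_le_mult_iff by linarith
    qed
    then show False using assms by simp
  qed
  then show ?thesis by (simp add: signed_count_def)
qed

text \<open>Here all sets \<open>neg_weights w b\<close> are empty, so the count is the number of
  linear extensions whose chamber contains \<open>a\<close>. A regular \<open>a\<close> lies in
  exactly one chamber, and that chamber is a linear extension exactly when \<open>a\<close> is
  nonnegative on \<open>P\<close>.\<close>

lemma signed_count_eq_indicator:
  assumes P: "P \<subseteq> roots_B" and a: "regular a"
    and b: "\<And>w i. w \<in> linear_extensions P \<Longrightarrow> b \<bullet> act w (weight i) \<ge> 0"
  shows "signed_count P a b = indicator (weight_cone P) a"
proof -
  define S where "S = {w \<in> linear_extensions P. neg_roots w a = {}}"
  have "neg_weights w b = {}" if "w \<in> linear_extensions P" for w
    using b[OF that] by (auto simp: neg_weights_def not_less)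
  then have eq: "signed_count P a b = real (card S)"
    by (simp add: signed_count_def S_def if_distrib cong: if_cong flip: sum.inter_filter)
  have pos: "signed_perm w" "a \<bullet> act w (simple_root i) > 0" if "w \<in> S" for w i
  proof -
    show w: "signed_perm w" using that linear_extension_signed_perm[of w P] by (simp add: S_def)
    have "i \<notin> neg_roots w a" using that by (simp add: S_def)
    then show "a \<bullet> act w (simple_root i) > 0"
      using regular_act_simple_root[OF a w, of i] by (simp add: neg_roots_def)
  qed
  show ?thesis
  proof (cases "a \<in> weight_cone P")
    case True
    \<comment> \<open>With the empty face there is no constraint on the rays, and any starting
      chamber will do.\<close>
    obtain w where w: "signed_perm w" "\<And>i. a \<bullet> act w (simple_root i) \<ge> 0"
      using exists_chamber_on_face[of id "{}" a] by (auto simp: signed_perm_def)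
    have "\<alpha> \<in> act w ` pos_roots_B" if \<alpha>: "\<alpha> \<in> P" for \<alpha>
    proof (rule ccontr)
      assume "\<alpha> \<notin> act w ` pos_roots_B"
      then have neg: "\<alpha> \<bullet> act w (weight k) \<le> 0" for k
        using act_root_sign_dichotomy[OF w(1), of \<alpha>] \<alpha> P by blast
      have "a \<bullet> \<alpha> \<le> 0"
        unfolding inner_expansion[OF w(1), of a \<alpha>]
        using w(2) neg by (intro sum_nonpos) (simp add: mult_nonneg_nonpos)
      moreover have "a \<bullet> \<alpha> \<ge> 0" using True \<alpha> by (simp add: weight_cone_def)
      moreover have "a \<bullet> \<alpha> \<noteq> 0" using a \<alpha> P by (auto simp: regular_def)
      ultimately show False by simp
    qed
    then have "w \<in> S" using w by (auto simp: S_def linear_extensions_def neg_roots_def not_less)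
    moreover have "v = w" if "v \<in> S" for v
      by (rule chamber_on_face_unique[of v w "{}" a]) (use that \<open>w \<in> S\<close> pos in auto)
    ultimately have "S = {w}" by blast
    then show ?thesis using True by (simp add: eq)
  next
    case False
    have "S = {}"
    proof (rule ccontr)
      assume "S \<noteq> {}"
      then obtain w where w: "w \<in> S" by blast
      have "a \<bullet> \<alpha> \<ge> 0" if "\<alpha> \<in> P" for \<alpha>
        unfolding inner_expansion[OF pos(1)[OF w], of a \<alpha>]
        using pos(2)[OF w] w linear_extension_inner_weight[OF _ that, of w]
        by (intro sum_nonneg) (simp add: S_def less_imp_le)
      then show False using False by (simp add: weight_cone_def)
    qed
    then show ?thesis using False by (simp add: eq)
  qed
qed

subsection \<open>Integrals over simplicial cones\<close>

text \<open>The preimage of a box under \<open>g\<close> is its image under the inverse of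
  \<open>g\<close>, and that map also has determinant of absolute value 1, so it preserves
  volume.\<close>

lemma distr_lborel_linear_det_1:
  fixes g :: "real^'n::{finite,wellorder} \<Rightarrow> real^'n::_"
  assumes g: "linear g" and det: "\<bar>det (matrix g)\<bar> = 1"
  shows "distr lborel borel g = lborel"
proof (rule sym, rule lborel_eqI)
  have "inj g" using det_nz_iff_inj[OF g] det by force
  then obtain h where h: "linear h" "\<And>x. h (g x) = x" "\<And>x. g (h x) = x"
    using linear_injective_isomorphism[OF g] by blast
  have "matrix g ** matrix h = mat 1"
  proof -
    have "g \<circ> h = id" using h(3) by auto
    then show ?thesis using matrix_compose[OF h(1) g] matrix_id_mat_1 by metis
  qed
  then have "det (matrix g) * det (matrix h) = 1" by (metis det_I det_mul)
  then have deth: "\<bar>det (matrix h)\<bar> = 1" by (metis abs_mult abs_one det mult_1)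
  have [measurable]: "g \<in> borel_measurable borel"
    by (intro borel_measurable_continuous_onI linear_continuous_on linear_linear[THEN iffD1] g)
      (simp add: g linear_conv_bounded_linear[symmetric])
  fix l u :: "real^'n::_"
  assume le: "\<And>b. b \<in> Basis \<Longrightarrow> l \<bullet> b \<le> u \<bullet> b"
  have "x \<in> h ` box l u \<longleftrightarrow> g x \<in> box l u" for x using h(2,3) by (metis imageE imageI)
  then have image_h: "h ` box l u = g -` box l u" by auto
  then have "emeasure (distr lborel borel g) (box l u) = emeasure lborel (h ` box l u)"
    by (simp add: emeasure_distr image_h)
  also have "\<dots> = emeasure lebesgue (h ` box l u)"
  proof -
    have "h ` box l u = g -` box l u \<inter> space borel" by (simp add: image_h)
    also have "\<dots> \<in> sets borel" by measurable
    finally have "h ` box l u \<in> sets lborel" by simp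
    then show ?thesis by simp
  qed
  also have "\<dots> = emeasure lebesgue (box l u)"
  proof -
    have "box l u \<in> lmeasurable" by simp
    then have "h ` box l u \<in> lmeasurable" "measure lebesgue (h ` box l u) = measure lebesgue (box l u)"
      using measurable_linear_image[OF h(1), of "box l u"] measure_linear_image[OF h(1), of "box l u"] deth
      by simp_all
    then show ?thesis using \<open>box l u \<in> lmeasurable\<close> by (metis emeasure_eq_measure2)
  qed
  also have "\<dots> = (\<Prod>b\<in>Basis. (u - l) \<bullet> b)" using le by simp
  finally show "emeasure (distr lborel borel g) (box l u) = (\<Prod>b\<in>Basis. (u - l) \<bullet> b)" .
qed simp

lemma nn_integral_exp_half_line:
  fixes l :: real
  assumes "l \<noteq> 0"
  shows "(\<integral>\<^sup>+c. ennreal (if c < 0 \<longleftrightarrow> l < 0 then exp (- (l * c)) else 0) \<partial>lborel) = ennreal (1 / \<bar>l\<bar>)"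
proof -
  have pos: "(\<integral>\<^sup>+c. ennreal (if c < 0 then 0 else exp (- (k * c))) \<partial>lborel) = ennreal (1 / k)" if k: "k > 0" for k :: real
  proof -
    have "((\<lambda>c. exp (- k * c)) has_integral exp (- k * 0) / k) {0..}"
      by (rule has_integral_exp_minus_to_infinity[OF k])
    then have "((\<lambda>c. if c \<in> {0..} then exp (- (k * c)) else 0) has_integral 1 / k) UNIV"
      by (simp only: has_integral_restrict_UNIV) simp
    then have "((\<lambda>c. if c < 0 then 0 else exp (- (k * c))) has_integral 1 / k) UNIV"
      by (rule has_integral_eq[rotated]) auto
    then show ?thesis by (intro nn_integral_has_integral_lborel) auto
  qed
  show ?thesis
  proof (cases "l > 0")
    case True
    then have "(\<integral>\<^sup>+c. ennreal (if c < 0 \<longleftrightarrow> l < 0 then exp (- (l * c)) else 0) \<partial>lborel)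
        = (\<integral>\<^sup>+c. ennreal (if c < 0 then 0 else exp (- (l * c))) \<partial>lborel)"
      by (intro nn_integral_cong) auto
    then show ?thesis using True pos[OF True] by simp
  next
    case False
    then have l: "- l > 0" using assms by simp
    have "(\<integral>\<^sup>+c. ennreal (if c < 0 \<longleftrightarrow> l < 0 then exp (- (l * c)) else 0) \<partial>lborel)
        = (\<integral>\<^sup>+c. ennreal (if - c < 0 \<longleftrightarrow> l < 0 then exp (- (l * (- c))) else 0) \<partial>lborel)"
      \<comment> \<open>Reflection in the origin reduces a negative slope to a positive one.\<close>
      by (subst (1) nn_integral_real_affine[where c = "-1" and t = 0]) (auto simp: algebra_simps cong: if_cong)
    also have "\<dots> = (\<integral>\<^sup>+c. ennreal (if c < 0 then 0 else exp (- ((- l) * c))) \<partial>lborel)"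
    \<comment> \<open>The reflected half-line is open and the other one closed; they differ only at
      the null set {0}.\<close>
    proof (rule nn_integral_cong_AE)
      have "AE c in lborel. c \<noteq> (0::real)" by (rule AE_lborel_singleton)
      then show "AE c in lborel. ennreal (if - c < 0 \<longleftrightarrow> l < 0 then exp (- (l * (- c))) else 0)
          = ennreal (if c < 0 then 0 else exp (- ((- l) * c)))"
        by eventually_elim (use l in auto)
    qed
    also have "\<dots> = ennreal (1 / \<bar>l\<bar>)" using pos[OF l] l by simp
    finally show ?thesis .
  qed
qed

text \<open>In the coordinates c of u with respect to \<open>A\<close>, which preserve volume, the
  domain is an orthant because c_i is the pairing of u with \<open>B i\<close>. The integrand
  becomes a product over the coordinates, and Tonelli leaves integrals over half-lines. The sign
  condition makes every exponent nonpositive, which gives convergence.\<close>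

lemma simplicial_cone_integral:
  fixes A B :: "'n::{finite,wellorder} \<Rightarrow> real^'n::_"
  assumes dual: "\<And>i j. A i \<bullet> B j = (if i = j then 1 else 0)"
    and det: "\<bar>det (\<chi> i. A i)\<bar> = 1"
    and x: "\<And>i. x \<bullet> A i \<noteq> 0"
  shows "has_bochner_integral lborel
    (\<lambda>u. if {i. u \<bullet> B i < 0} = {i. x \<bullet> A i < 0} then exp (- (x \<bullet> u)) else 0) (\<Prod>i\<in>UNIV. 1 / \<bar>x \<bullet> A i\<bar>)"
proof -
  define g where "g c = (\<Sum>i\<in>UNIV. (c $ i) *\<^sub>R A i)" for c :: "real^'n::_"
  define F where "F u = (if {i. u \<bullet> B i < 0} = {i. x \<bullet> A i < 0} then exp (- (x \<bullet> u)) else 0)" for u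
  define f where "f i c = (if c < 0 \<longleftrightarrow> x \<bullet> A i < 0 then exp (- ((x \<bullet> A i) * c)) else 0)" for i c
  have g: "linear g" by (rule linearI) (simp_all add: g_def algebra_simps sum.distrib scaleR_sum_right)
  have "matrix g = Finite_Cartesian_Product.transpose (\<chi> i. A i)"
    by (simp add: matrix_def Finite_Cartesian_Product.transpose_def vec_eq_iff g_def axis_def
        if_distrib[of "\<lambda>a. a * _"] cong: if_cong)
  then have detg: "\<bar>det (matrix g)\<bar> = 1" using det by (simp add: det_transpose)
  have [measurable]: "g \<in> borel_measurable borel"
    unfolding g_def by (intro borel_measurable_continuous_onI continuous_intros)
  have F_borel [measurable]: "F \<in> borel_measurable borel"
  proof -
    have "F = (\<lambda>u. if \<forall>i. u \<bullet> B i < 0 \<longleftrightarrow> x \<bullet> A i < 0 then exp (- (x \<bullet> u)) else 0)"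
      by (auto simp: F_def fun_eq_iff)
    also have "\<dots> \<in> borel_measurable borel" by measurable
    finally show ?thesis .
  qed
  have [measurable]: "f i \<in> borel_measurable borel" for i unfolding f_def by measurable
  have f_nonneg: "f i c \<ge> 0" for i c by (simp add: f_def)
  have gB: "g c \<bullet> B i = c $ i" for c i
    by (simp add: g_def inner_sum_left dual if_distrib cong: if_cong)
  have Fg: "F (g c) = (\<Prod>i\<in>UNIV. f i (c $ i))" for c
  proof (cases "\<forall>i. c $ i < 0 \<longleftrightarrow> x \<bullet> A i < 0")
    case True
    then have "F (g c) = exp (\<Sum>i\<in>UNIV. - ((x \<bullet> A i) * c $ i))"
      by (simp add: F_def gB) (simp add: g_def inner_sum_right sum_negf mult.commute)
    then show ?thesis using True by (simp add: exp_sum f_def)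
  next
    \<comment> \<open>A single violated sign makes one factor vanish, so the product also reproduces
      the boundary of the domain.\<close>
    case False
    then have "\<exists>i. f i (c $ i) = 0" by (auto simp: f_def)
    then have "(\<Prod>i\<in>UNIV. f i (c $ i)) = 0" by (simp add: prod_zero_iff)
    moreover have "F (g c) = 0" using False by (auto simp: F_def gB)
    ultimately show ?thesis by simp
  qed
  have "(\<integral>\<^sup>+u. F u \<partial>lborel) = (\<integral>\<^sup>+u. F u \<partial>(distr lborel borel g))"
    by (simp add: distr_lborel_linear_det_1[OF g detg])
  also have "\<dots> = (\<integral>\<^sup>+c. F (g c) \<partial>lborel)" by (rule nn_integral_distr) auto
  also have "\<dots> = (\<integral>\<^sup>+c. (\<Prod>b\<in>Basis. ennreal (f (axis_index b) ((c :: real^'n::_) \<bullet> b))) \<partial>lborel)"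
  proof (rule nn_integral_cong)
    fix c :: "real^'n::_"
    have B: "(Basis :: (real^'n::_) set) = range evec" by (auto simp: Basis_vec_def)
    have inj: "inj (evec :: 'n \<Rightarrow> real^'n::_)" by (auto simp: inj_def axis_eq_axis)
    show "ennreal (F (g c)) = (\<Prod>b\<in>Basis. ennreal (f (axis_index b) (c \<bullet> b)))"
      unfolding B prod.reindex[OF inj]
      by (simp add: Fg inner_axis prod_ennreal f_nonneg)
  qed
  also have "\<dots> = (\<Prod>b\<in>(Basis :: (real^'n::_) set). \<integral>\<^sup>+c. ennreal (f (axis_index b) c) \<partial>lborel)"
    by (rule nn_integral_lborel_prod) auto
  also have "\<dots> = (\<Prod>b\<in>(Basis :: (real^'n::_) set). ennreal (1 / \<bar>x \<bullet> A (axis_index b)\<bar>))"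
    unfolding f_def by (intro prod.cong refl nn_integral_exp_half_line x)
  also have "\<dots> = ennreal (\<Prod>i\<in>UNIV. 1 / \<bar>x \<bullet> A i\<bar>)"
  proof -
    have B: "(Basis :: (real^'n::_) set) = range evec" by (auto simp: Basis_vec_def)
    have inj: "inj (evec :: 'n \<Rightarrow> real^'n::_)" by (auto simp: inj_def axis_eq_axis)
    show ?thesis unfolding B prod.reindex[OF inj] by (simp add: prod_ennreal axis_index_axis)
  qed
  finally have "(\<integral>\<^sup>+u. F u \<partial>lborel) = ennreal (\<Prod>i\<in>UNIV. 1 / \<bar>x \<bullet> A i\<bar>)" .
  then have "has_bochner_integral lborel F (\<Prod>i\<in>UNIV. 1 / \<bar>x \<bullet> A i\<bar>)"
    by (intro has_bochner_integral_nn_integral) (auto simp: F_def prod_nonneg)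
  then show ?thesis by (simp add: F_def[abs_def])
qed

subsection \<open>Vectors off finitely many hyperplanes\<close>

lemma open_off_hyperplanes:
  fixes H :: "'a::euclidean_space set"
  assumes "finite H"
  shows "open {x. \<forall>h\<in>H. x \<bullet> h \<noteq> 0}"
proof -
  have "{x. \<forall>h\<in>H. x \<bullet> h \<noteq> 0} = (\<Inter>h\<in>H. {x. x \<bullet> h \<noteq> 0})" by auto
  also have "open \<dots>" by (intro open_INT assms ballI open_Collect_neq continuous_intros)
  finally show ?thesis .
qed

text \<open>Finitely many hyperplanes form a null set, which cannot cover a nonempty open
  set.\<close>

lemma exists_off_hyperplanes:
  fixes H :: "'a::euclidean_space set"
  assumes "finite H" "0 \<notin> H" "open U" "U \<noteq> {}"
  obtains x where "x \<in> U" "\<And>h. h \<in> H \<Longrightarrow> x \<bullet> h \<noteq> 0"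
proof -
  have "negligible (\<Union>h\<in>H. {x. h \<bullet> x = 0})"
    using assms(1,2) by (intro negligible_Union) (auto intro!: negligible_hyperplane)
  then have "\<not> U \<subseteq> (\<Union>h\<in>H. {x. h \<bullet> x = 0})"
    using open_not_negligible[OF assms(3,4)] negligible_subset by blast
  then show thesis using that by (auto simp: inner_commute) (metis inner_commute)
qed

lemma off_hyperplanes_nonempty:
  fixes H :: "'a::euclidean_space set"
  assumes "finite H" "0 \<notin> H" "open U" "U \<noteq> {}"
  shows "U \<inter> {x. \<forall>h\<in>H. x \<bullet> h \<noteq> 0} \<noteq> {}"
proof -
  obtain x where "x \<in> U" "\<And>h. h \<in> H \<Longrightarrow> x \<bullet> h \<noteq> 0" using exists_off_hyperplanes[OF assms] by metis
  then have "x \<in> U \<inter> {x. \<forall>h\<in>H. x \<bullet> h \<noteq> 0}" by simp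
  then show ?thesis by auto
qed

text \<open>If \<open>x\<close> is off a hyperplane, continuity keeps nearby points off it. If
  \<open>x\<close> is on it, the pairing is a nonzero multiple of \<open>e\<close>, and the filter
  excludes \<open>e = 0\<close>.\<close>

lemma eventually_off_hyperplanes:
  fixes H :: "'a::euclidean_space set"
  assumes "finite H" "\<And>h. h \<in> H \<Longrightarrow> d \<bullet> h \<noteq> 0"
  shows "\<forall>\<^sub>F e in at 0. \<forall>h\<in>H. (x + e *\<^sub>R d) \<bullet> h \<noteq> 0"
proof (rule eventually_ball_finite[OF assms(1)], rule ballI)
  fix h assume h: "h \<in> H"
  show "\<forall>\<^sub>F e in at 0. (x + e *\<^sub>R d) \<bullet> h \<noteq> 0"
  proof (cases "x \<bullet> h = 0")
    case True
    then show ?thesis using assms(2)[OF h]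
      by (simp add: eventually_at_filter inner_add_left)
  next
    case False
    have "((\<lambda>e. (x + e *\<^sub>R d) \<bullet> h) \<longlongrightarrow> (x + 0 *\<^sub>R d) \<bullet> h) (at 0)" by (intro tendsto_intros)
    then show ?thesis using False by (intro tendsto_imp_eventually_ne[of _ "x \<bullet> h"]) auto
  qed
qed

subsection \<open>Evaluation of rational functions\<close>

definition mono_eval :: "('n \<Rightarrow>\<^sub>0 nat) \<Rightarrow> real^'n::{finite,wellorder} \<Rightarrow> real" where
  "mono_eval m x = (\<Prod>i\<in>UNIV. (x $ i) ^ Poly_Mapping.lookup m i)"

lemma mono_eval_add: "mono_eval (m + m') x = mono_eval m x * mono_eval m' x"
  by (simp add: mono_eval_def lookup_add power_add prod.distrib)

lemma peval_superset:
  assumes "finite S" "Poly_Mapping.keys p \<subseteq> S"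
  shows "peval p x = (\<Sum>m\<in>S. Poly_Mapping.lookup p m * mono_eval m x)"
  unfolding peval_def mono_eval_def[symmetric]
  using assms by (intro sum.mono_neutral_left) (auto simp: in_keys_iff)

lemma peval_0 [simp]: "peval 0 x = 0"
  by (simp add: peval_def)

lemma peval_add: "peval (p + q) x = peval p x + peval q x"
proof -
  \<comment> \<open>Cancellation may shrink the support of the sum, so all three evaluations are
    written over one common support.\<close>
  let ?S = "Poly_Mapping.keys p \<union> Poly_Mapping.keys q"
  have "peval (p + q) x = (\<Sum>m\<in>?S. Poly_Mapping.lookup (p + q) m * mono_eval m x)"
    by (rule peval_superset) (use Poly_Mapping.keys_add[of p q] in auto)
  moreover have "peval p x = (\<Sum>m\<in>?S. Poly_Mapping.lookup p m * mono_eval m x)"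
    "peval q x = (\<Sum>m\<in>?S. Poly_Mapping.lookup q m * mono_eval m x)"
    by (rule peval_superset; auto)+
  ultimately show ?thesis by (simp add: lookup_add algebra_simps sum.distrib)
qed

lemma peval_sum: "peval (\<Sum>i\<in>I. f i) x = (\<Sum>i\<in>I. peval (f i) x)"
  by (induction I rule: infinite_finite_induct) (auto simp: peval_add)

lemma peval_single: "peval (Poly_Mapping.single m c) x = c * mono_eval m x"
  by (subst peval_superset[of "{m}"]) auto

lemma peval_1 [simp]: "peval 1 x = 1"
  using peval_single[of 0 1 x] by (simp add: mono_eval_def)

lemma sum_single_lookup:
  fixes p :: "'a \<Rightarrow>\<^sub>0 'b::comm_monoid_add"
  shows "(\<Sum>m\<in>Poly_Mapping.keys p. Poly_Mapping.single m (Poly_Mapping.lookup p m)) = p"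
  by (rule poly_mapping_eqI) (auto simp: lookup_sum lookup_single when_def in_keys_iff)

lemma peval_mult: "peval (p * q) x = peval p x * peval q x"
proof -
  let ?s = "\<lambda>p m. Poly_Mapping.single m (Poly_Mapping.lookup p m)"
  have "p * q = (\<Sum>m\<in>Poly_Mapping.keys p. ?s p m) * (\<Sum>n\<in>Poly_Mapping.keys q. ?s q n)"
    by (simp add: sum_single_lookup)
  then have "peval (p * q) x = (\<Sum>m\<in>Poly_Mapping.keys p. \<Sum>n\<in>Poly_Mapping.keys q.
      (Poly_Mapping.lookup p m * mono_eval m x) * (Poly_Mapping.lookup q n * mono_eval n x))"
    by (simp add: sum_product mult_single peval_sum peval_single mono_eval_add mult_ac)
  then show ?thesis by (simp add: peval_def mono_eval_def sum_product)
qed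

lemma peval_uminus: "peval (- p) x = - peval p x"
  using peval_add[of p "- p" x] by simp

lemma peval_diff: "peval (p - q) x = peval p x - peval q x"
  using peval_add[of p "- q" x] by (simp add: peval_uminus)

lemma continuous_on_peval [continuous_intros]:
  "continuous_on S f \<Longrightarrow> continuous_on S (\<lambda>y. peval p (f y))"
  unfolding peval_def by (intro continuous_intros)

text \<open>Along the curve with coordinates exp(s d_i), each monomial becomes a single exponential
  in s. For generic \<open>d\<close> the growth rates of the monomials of \<open>p\<close> are
  distinct; dividing by the fastest and letting s tend to infinity isolates a nonzero
  coefficient.\<close>

lemma peval_eq_0_imp_eq_0:
  assumes zero: "\<And>x. peval p x = 0"
  shows "p = 0"
proof (rule ccontr)
  assume "p \<noteq> 0"
  define v :: "('a \<Rightarrow>\<^sub>0 nat) \<Rightarrow> real^'a::_" where "v m = (\<chi> i. real (Poly_Mapping.lookup m i))" for m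
  have v_inj: "m = m'" if "v m = v m'" for m m'
    using that by (auto simp: v_def vec_eq_iff intro!: poly_mapping_eqI)
  \<comment> \<open>A vector \<open>d\<close> off these hyperplanes separates the exponent vectors
    of any two monomials of \<open>p\<close>.\<close>
  let ?H = "(\<lambda>(m, m'). v m - v m') ` (Poly_Mapping.keys p \<times> Poly_Mapping.keys p) - {0}"
  obtain d where d: "\<And>h. h \<in> ?H \<Longrightarrow> d \<bullet> h \<noteq> 0"
    using exists_off_hyperplanes[of ?H UNIV] by auto
  have d_inj: "m = m'" if "m \<in> Poly_Mapping.keys p" "m' \<in> Poly_Mapping.keys p" "d \<bullet> v m = d \<bullet> v m'" for m m'
  proof (rule ccontr)
    assume "m \<noteq> m'"
    then have "v m - v m' \<in> ?H" using that v_inj by force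
    then show False using d[of "v m - v m'"] that by (simp add: inner_diff_right)
  qed
  let ?f = "\<lambda>m. d \<bullet> v m"
  have "finite (?f ` Poly_Mapping.keys p)" "?f ` Poly_Mapping.keys p \<noteq> {}" using \<open>p \<noteq> 0\<close> by auto
  then have "Max (?f ` Poly_Mapping.keys p) \<in> ?f ` Poly_Mapping.keys p" by (rule Max_in)
  then obtain m0 where m0: "m0 \<in> Poly_Mapping.keys p" "?f m0 = Max (?f ` Poly_Mapping.keys p)" by auto
  have lt: "?f m < ?f m0" if "m \<in> Poly_Mapping.keys p" "m \<noteq> m0" for m
  proof -
    have "?f m \<le> ?f m0" unfolding m0(2) using that by simp
    moreover have "?f m \<noteq> ?f m0" using d_inj[OF that(1) m0(1)] that(2) by blast
    ultimately show ?thesis by simp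
  qed
  define g where "g = (\<lambda>s::real. (\<Sum>m\<in>Poly_Mapping.keys p. Poly_Mapping.lookup p m * exp ((?f m - ?f m0) * s)))"
  have g0: "g s = 0" for s
  proof -
    define x :: "real^'a::_" where "x = (\<chi> i. exp (s * d $ i))"
    have mono: "mono_eval m x = exp (?f m * s)" for m
      by (simp add: mono_eval_def x_def v_def inner_vec_def sum_distrib_right sum_distrib_left mult_ac
          flip: exp_of_nat_mult exp_sum)
    have "g s = exp (- (?f m0 * s)) * (\<Sum>m\<in>Poly_Mapping.keys p. Poly_Mapping.lookup p m * exp (?f m * s))"
      by (simp add: g_def sum_distrib_left left_diff_distrib exp_diff exp_minus field_simps)
    also have "(\<Sum>m\<in>Poly_Mapping.keys p. Poly_Mapping.lookup p m * exp (?f m * s)) = peval p x"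
      by (simp add: peval_def mono flip: mono_eval_def)
    finally show ?thesis by (simp add: zero)
  qed
  have "(g \<longlongrightarrow> (\<Sum>m\<in>Poly_Mapping.keys p. Poly_Mapping.lookup p m * (if m = m0 then 1 else 0))) at_top"
    unfolding g_def
  proof (intro tendsto_sum tendsto_mult tendsto_const)
    fix m assume m: "m \<in> Poly_Mapping.keys p"
    show "((\<lambda>s. exp ((?f m - ?f m0) * s)) \<longlongrightarrow> (if m = m0 then 1 else 0)) at_top"
    proof (cases "m = m0")
      case False
      then have "?f m - ?f m0 < 0" using lt[OF m] by simp
      then have "filterlim (\<lambda>s. (?f m - ?f m0) * s) at_bot at_top"
        by (simp add: filterlim_tendsto_neg_mult_at_bot[OF tendsto_const] filterlim_ident)
      then show ?thesis using False by (auto intro: filterlim_compose[OF exp_at_bot])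
    qed simp
  qed
  moreover have "g = (\<lambda>s. 0)" using g0 by auto
  ultimately have "((\<lambda>s. 0) \<longlongrightarrow> Poly_Mapping.lookup p m0) (at_top :: real filter)"
    using m0(1) by (simp add: if_distrib sum.delta cong: if_cong)
  then have "Poly_Mapping.lookup p m0 = 0"
    by (simp add: tendsto_const_iff)
  then show False using m0(1) by (simp add: in_keys_iff)
qed

text \<open>Restrict \<open>p\<close> to the line from a point of \<open>U\<close> to an arbitrary
  point \<open>y\<close>. This polynomial in one variable has infinitely many roots near 0, so it is
  zero, also at t = 1, where the line reaches \<open>y\<close>.\<close>

lemma peval_eq_0_on_open_imp_eq_0:
  assumes "open U" "U \<noteq> {}" and zero: "\<And>x. x \<in> U \<Longrightarrow> peval p x = 0"
  shows "p = 0"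
proof (rule peval_eq_0_imp_eq_0)
  fix y :: "real^'a::_"
  obtain x where x: "x \<in> U" using assms(2) by blast
  define c where "c = (\<Sum>m\<in>Poly_Mapping.keys p. Polynomial.smult (Poly_Mapping.lookup p m)
      (\<Prod>i\<in>UNIV. [:x $ i, y $ i - x $ i:] ^ Poly_Mapping.lookup m i))"
  have c: "poly c t = peval p (x + t *\<^sub>R (y - x))" for t
    by (simp add: c_def peval_def poly_sum poly_prod poly_power algebra_simps)
  have "((\<lambda>t. x + t *\<^sub>R (y - x)) \<longlongrightarrow> x + 0 *\<^sub>R (y - x)) (at 0)" by (intro tendsto_intros)
  then have "\<forall>\<^sub>F t in at 0. x + t *\<^sub>R (y - x) \<in> U"
    using topological_tendstoD[OF _ assms(1)] x by force
  then have "\<forall>\<^sub>F t in at 0. poly c t = 0" by eventually_elim (simp add: c zero)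
  then obtain e where e: "e > 0" "\<And>t. t \<noteq> 0 \<Longrightarrow> \<bar>t\<bar> < e \<Longrightarrow> poly c t = 0"
    unfolding eventually_at by (auto simp: dist_real_def)
  have "c = 0"
  proof (rule ccontr)
    assume "c \<noteq> 0"
    then have "finite {t. poly c t = 0}" by (rule poly_roots_finite)
    moreover have "{0<..<e} \<subseteq> {t. poly c t = 0}" using e(2) by auto
    ultimately show False using e(1) infinite_Ioo[of 0 e] finite_subset by blast
  qed
  then show "peval p y = 0" using c[of 1] by simp
qed

definition has_value :: "'n::{finite,wellorder} ratfun \<Rightarrow> real^'n::_ \<Rightarrow> real \<Rightarrow> bool" where
  "has_value R x r \<longleftrightarrow> (\<exists>p q. R = Fract p q \<and> peval q x \<noteq> 0 \<and> r = peval p x / peval q x)"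

lemma has_valueE:
  assumes "has_value R x r"
  obtains p q where "R = Fract p q" "q \<noteq> 0" "peval q x \<noteq> 0" "r = peval p x / peval q x"
  using assms unfolding has_value_def by (metis peval_0)

lemma has_valueI: "peval q x \<noteq> 0 \<Longrightarrow> has_value (Fract p q) x (peval p x / peval q x)"
  unfolding has_value_def by blast

lemma has_value_unique:
  assumes "has_value R x r" "has_value R x r'"
  shows "r = r'"
proof -
  obtain p q where pq: "R = Fract p q" "q \<noteq> 0" "peval q x \<noteq> 0" "r = peval p x / peval q x"
    using assms(1) by (rule has_valueE)
  obtain p' q' where pq': "R = Fract p' q'" "q' \<noteq> 0" "peval q' x \<noteq> 0" "r' = peval p' x / peval q' x"
    using assms(2) by (rule has_valueE)
  have "p * q' = p' * q" using pq(1,2) pq'(1,2) by (simp add: eq_fract)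
  then have "peval p x * peval q' x = peval p' x * peval q x" by (metis peval_mult)
  then show ?thesis using pq(3,4) pq'(3,4) by (simp add: frac_eq_eq)
qed

lemma has_value_add:
  assumes "has_value R x r" "has_value R' x r'"
  shows "has_value (R + R') x (r + r')"
proof -
  obtain p q where pq: "R = Fract p q" "q \<noteq> 0" "peval q x \<noteq> 0" "r = peval p x / peval q x"
    using assms(1) by (rule has_valueE)
  obtain p' q' where pq': "R' = Fract p' q'" "q' \<noteq> 0" "peval q' x \<noteq> 0" "r' = peval p' x / peval q' x"
    using assms(2) by (rule has_valueE)
  show ?thesis
    using has_valueI[of "q * q'" x "p * q' + p' * q"] pq pq'
    by (simp add: peval_mult peval_add add_divide_distrib)
qed

lemma has_value_mult:
  assumes "has_value R x r" "has_value R' x r'"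
  shows "has_value (R * R') x (r * r')"
proof -
  obtain p q where pq: "R = Fract p q" "q \<noteq> 0" "peval q x \<noteq> 0" "r = peval p x / peval q x"
    using assms(1) by (rule has_valueE)
  obtain p' q' where pq': "R' = Fract p' q'" "q' \<noteq> 0" "peval q' x \<noteq> 0" "r' = peval p' x / peval q' x"
    using assms(2) by (rule has_valueE)
  show ?thesis
    using has_valueI[of "q * q'" x "p * p'"] pq pq' by (simp add: peval_mult)
qed

lemma has_value_inverse:
  assumes "has_value R x r" "r \<noteq> 0"
  shows "has_value (inverse R) x (inverse r)"
proof -
  obtain p q where pq: "R = Fract p q" "q \<noteq> 0" "peval q x \<noteq> 0" "r = peval p x / peval q x"
    using assms(1) by (rule has_valueE)
  then show ?thesis using has_valueI[of p x q] assms(2) by auto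
qed

lemma has_value_0: "has_value 0 x 0"
  using has_valueI[of 1 x 0] by (simp add: Zero_fract_def)

lemma has_value_1: "has_value 1 x 1"
  using has_valueI[of 1 x 1] by (simp add: One_fract_def)

lemma has_value_sum:
  "(\<And>i. i \<in> I \<Longrightarrow> has_value (f i) x (g i)) \<Longrightarrow> has_value (\<Sum>i\<in>I. f i) x (\<Sum>i\<in>I. g i)"
  by (induction I rule: infinite_finite_induct) (auto simp: has_value_0 intro: has_value_add)

lemma has_value_prod:
  "(\<And>i. i \<in> I \<Longrightarrow> has_value (f i) x (g i)) \<Longrightarrow> has_value (\<Prod>i\<in>I. f i) x (\<Prod>i\<in>I. g i)"
  by (induction I rule: infinite_finite_induct) (auto simp: has_value_1 intro: has_value_mult)

lemma has_value_lin_form: "has_value (lin_form v) x (x \<bullet> v)"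
proof -
  have "mono_eval (Poly_Mapping.single i 1) x = x $ i" for i
  proof -
    have "mono_eval (Poly_Mapping.single i 1) x = (\<Prod>j\<in>UNIV. if j = i then x $ j else 1)"
      unfolding mono_eval_def by (intro prod.cong) (auto simp: lookup_single when_def)
    then show ?thesis by simp
  qed
  then have "peval (\<Sum>i\<in>UNIV. Poly_Mapping.single (Poly_Mapping.single i 1) (v $ i)) x = x \<bullet> v"
    by (simp add: peval_sum peval_single inner_vec_def mult.commute)
  then show ?thesis
    using has_valueI[of 1 x "\<Sum>i\<in>UNIV. Poly_Mapping.single (Poly_Mapping.single i 1) (v $ i)"]
    by (simp add: lin_form_def)
qed

lemma ratfun_eqI:
  assumes "open U" "U \<noteq> {}"
    and val: "\<And>x. x \<in> U \<Longrightarrow> \<exists>r. has_value R x r \<and> has_value R' x r"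
  shows "R = R'"
proof -
  obtain p q where pq: "R = Fract p q" "q \<noteq> 0" by (cases R)
  obtain p' q' where pq': "R' = Fract p' q'" "q' \<noteq> 0" by (cases R')
  \<comment> \<open>The common value at a point may come from other fractions than the ones fixed
    here. The extra factor handles the points where one of the fixed denominators vanishes.\<close>
  have "(p * q' - p' * q) * (q * q') = 0"
  proof (rule peval_eq_0_on_open_imp_eq_0[OF assms(1,2)])
    fix x assume "x \<in> U"
    then obtain r where r: "has_value R x r" "has_value R' x r" using val by blast
    show "peval ((p * q' - p' * q) * (q * q')) x = 0"
    proof (cases "peval q x = 0 \<or> peval q' x = 0")
      case True
      then show ?thesis by (auto simp: peval_mult)
    next
      case False
      then have "r = peval p x / peval q x" "r = peval p' x / peval q' x"
        using r has_valueI[of q x p] has_valueI[of q' x p'] pq(1) pq'(1) has_value_unique by blast+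
      then show ?thesis using False by (simp add: peval_mult peval_diff field_simps)
    qed
  qed
  then have "p * q' = p' * q" using pq(2) pq'(2) by simp
  then show ?thesis using pq pq' by (simp add: eq_fract)
qed

subsection \<open>Recognising the rational function of a cone\<close>

lemma eventually_interior_direction:
  fixes x d :: "'a::real_normed_vector"
  assumes "x \<in> interior D"
  shows "\<forall>\<^sub>F e in at 0. x + e *\<^sub>R d \<in> interior D"
proof -
  have "((\<lambda>e. x + e *\<^sub>R d) \<longlongrightarrow> x + 0 *\<^sub>R d) (at 0)" by (intro tendsto_intros)
  then show ?thesis using topological_tendstoD[OF _ open_interior] assms by force
qed

text \<open>The definition demands agreement wherever \<open>R\<close> is defined, while direct
  evaluation is available only off the hyperplanes of \<open>H\<close>. The gap is closed by
  approaching \<open>x\<close> along a direction \<open>d\<close> off these hyperplanes: the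
  fraction is continuous, and the integral converges by domination.\<close>

lemma extends_integralI:
  fixes K :: "(real^'n::{finite,wellorder}) set"
  assumes K: "closed K" and H: "finite H" "0 \<notin> H"
    and val: "\<And>x. x \<in> interior (dual_cone K) \<Longrightarrow> (\<And>h. h \<in> H \<Longrightarrow> x \<bullet> h \<noteq> 0) \<Longrightarrow>
      set_integrable lebesgue K (\<lambda>u. exp (- (x \<bullet> u))) \<and>
      has_value R x (LINT u:K|lebesgue. exp (- (x \<bullet> u)))"
  shows "extends_integral R K"
  unfolding extends_integral_def
proof (intro ballI conjI allI impI)
  fix x assume x: "x \<in> interior (dual_cone K)"
  obtain d where d: "d \<in> interior (dual_cone K)" "\<And>h. h \<in> H \<Longrightarrow> d \<bullet> h \<noteq> 0"
    using exists_off_hyperplanes[OF H open_interior, of "dual_cone K"] x by blast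
  have d_nonneg: "d \<bullet> u \<ge> 0" if "u \<in> K" for u
    using d(1) interior_subset that by (auto simp: dual_cone_def)
  have ev: "\<forall>\<^sub>F e in at 0. x + e *\<^sub>R d \<in> interior (dual_cone K) \<and> (\<forall>h\<in>H. (x + e *\<^sub>R d) \<bullet> h \<noteq> 0)"
    by (intro eventually_conj eventually_interior_direction x eventually_off_hyperplanes H(1) d(2))
  have [measurable]: "K \<in> sets lebesgue" using K by simp
  have [measurable]: "(\<lambda>u. exp (- (y \<bullet> u))) \<in> borel_measurable lebesgue" for y :: "real^'n::_"
    by (intro measurable_completion) simp
  show int: "set_integrable lebesgue K (\<lambda>u. exp (- (x \<bullet> u)))"
  proof -
    \<comment> \<open>Since \<open>d\<close> is nonnegative on \<open>K\<close>, a step backwards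
      along \<open>d\<close> enlarges the integrand, so integrability there gives integrability at
      \<open>x\<close>.\<close>
    have "\<forall>\<^sub>F e in at_left 0. x + e *\<^sub>R d \<in> interior (dual_cone K) \<and> (\<forall>h\<in>H. (x + e *\<^sub>R d) \<bullet> h \<noteq> 0)"
      using ev filter_leD[OF at_le, of "{..<0}" UNIV] by auto
    moreover have "\<forall>\<^sub>F e in at_left (0::real). e < 0" by (simp add: eventually_at_filter)
    ultimately have "\<forall>\<^sub>F e in at_left (0::real). e < 0 \<and> x + e *\<^sub>R d \<in> interior (dual_cone K) \<and>
        (\<forall>h\<in>H. (x + e *\<^sub>R d) \<bullet> h \<noteq> 0)" by eventually_elim auto
    then obtain e where e: "e < 0" "x + e *\<^sub>R d \<in> interior (dual_cone K)" "\<forall>h\<in>H. (x + e *\<^sub>R d) \<bullet> h \<noteq> 0"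
      using eventually_happens'[OF trivial_limit_at_left_real] by blast
    then have "set_integrable lebesgue K (\<lambda>u. exp (- ((x + e *\<^sub>R d) \<bullet> u)))" using val by blast
    then show ?thesis
      unfolding set_integrable_def
    proof (rule Bochner_Integration.integrable_bound)
      show "AE u in lebesgue. norm (indicator K u *\<^sub>R exp (- (x \<bullet> u)))
          \<le> norm (indicator K u *\<^sub>R exp (- ((x + e *\<^sub>R d) \<bullet> u)))"
        using e(1) d_nonneg
        by (intro AE_I2) (auto simp: indicator_def inner_add_left mult_nonpos_nonneg)
    qed measurable
  qed
  fix p q assume pq: "R = Fract p q \<and> peval q x \<noteq> 0"
  \<comment> \<open>Positive steps make the integrands smaller, so the integrand at \<open>x\<close>
    dominates them all.\<close>
  define X where "X k = x + inverse (real (Suc k)) *\<^sub>R d" for k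
  have inv: "filterlim (\<lambda>k. inverse (real (Suc k))) (at 0) sequentially"
    using LIMSEQ_inverse_real_of_nat by (auto simp: filterlim_at)
  have X: "X \<longlonglongrightarrow> x"
    unfolding X_def
    using tendsto_add[OF tendsto_const tendsto_scaleR[OF LIMSEQ_inverse_real_of_nat tendsto_const], of x d]
    by simp
  have evX: "\<forall>\<^sub>F k in sequentially. X k \<in> interior (dual_cone K) \<and> (\<forall>h\<in>H. X k \<bullet> h \<noteq> 0)"
    unfolding X_def using ev inv by (rule eventually_compose_filterlim)
  have pe: "(\<lambda>k. peval r (X k)) \<longlonglongrightarrow> peval r x" for r
  proof -
    have "continuous_on UNIV (\<lambda>x. peval r x)" by (intro continuous_intros)
    then have "isCont (peval r) x" by (simp add: continuous_on_eq_continuous_at)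
    then show ?thesis using X by (rule isCont_tendsto_compose)
  qed
  have "\<forall>\<^sub>F k in sequentially. peval q (X k) \<noteq> 0"
    using tendsto_imp_eventually_ne[OF pe] pq by blast
  with evX have eq: "\<forall>\<^sub>F k in sequentially. peval p (X k) / peval q (X k) = (LINT u:K|lebesgue. exp (- (X k \<bullet> u)))"
  proof eventually_elim
    case (elim k)
    then have "has_value R (X k) (LINT u:K|lebesgue. exp (- (X k \<bullet> u)))" using val by blast
    moreover have "has_value R (X k) (peval p (X k) / peval q (X k))" using has_valueI elim pq by blast
    ultimately show ?case by (rule has_value_unique[symmetric])
  qed
  have "(\<lambda>k. LINT u:K|lebesgue. exp (- (X k \<bullet> u))) \<longlonglongrightarrow> (LINT u:K|lebesgue. exp (- (x \<bullet> u)))"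
    unfolding set_lebesgue_integral_def
  proof (rule integral_dominated_convergence)
    show "integrable lebesgue (\<lambda>u. indicat_real K u *\<^sub>R exp (- (x \<bullet> u)))"
      using int by (simp add: set_integrable_def)
    show "AE u in lebesgue. (\<lambda>k. indicat_real K u *\<^sub>R exp (- (X k \<bullet> u))) \<longlonglongrightarrow> indicat_real K u *\<^sub>R exp (- (x \<bullet> u))"
      by (intro AE_I2 tendsto_intros X)
    show "AE u in lebesgue. norm (indicat_real K u *\<^sub>R exp (- (X k \<bullet> u))) \<le> indicat_real K u *\<^sub>R exp (- (x \<bullet> u))" for k
      using d_nonneg by (intro AE_I2) (auto simp: indicator_def X_def inner_add_left)
  qed measurable
  then have "(\<lambda>k. peval p (X k) / peval q (X k)) \<longlonglongrightarrow> (LINT u:K|lebesgue. exp (- (x \<bullet> u)))"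
    by (rule tendsto_cong[OF eq, THEN iffD2])
  moreover have "(\<lambda>k. peval p (X k) / peval q (X k)) \<longlonglongrightarrow> peval p x / peval q x"
    using pe pq by (intro tendsto_divide) auto
  ultimately show "peval p x / peval q x = (LINT u:K|lebesgue. exp (- (x \<bullet> u)))"
    by (rule LIMSEQ_unique[rotated])
qed

lemma cone_integral_eqI:
  fixes K :: "(real^'n::{finite,wellorder}) set"
  assumes "closed K" "pointed K" "full_dimensional K" "interior (dual_cone K) \<noteq> {}"
    and H: "finite H" "0 \<notin> H"
    and val: "\<And>x. x \<in> interior (dual_cone K) \<Longrightarrow> (\<And>h. h \<in> H \<Longrightarrow> x \<bullet> h \<noteq> 0) \<Longrightarrow>
      set_integrable lebesgue K (\<lambda>u. exp (- (x \<bullet> u))) \<and>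
      has_value R x (LINT u:K|lebesgue. exp (- (x \<bullet> u)))"
  shows "cone_integral K = R"
proof -
  have ext: "extends_integral R K" by (rule extends_integralI[OF assms(1) H val])
  have "R' = R" if "extends_integral R' K" for R'
  proof -
    obtain p q where pq: "R = Fract p q" "q \<noteq> 0" by (cases R)
    obtain p' q' where pq': "R' = Fract p' q'" "q' \<noteq> 0" by (cases R')
    \<comment> \<open>On this set both denominators are nonzero, so both functions equal the
      integral; the product of the denominators cannot vanish on the whole interior.\<close>
    let ?U = "interior (dual_cone K) \<inter> {x. peval (q * q') x \<noteq> 0}"
    have "open ?U"
      by (intro open_Int open_interior open_Collect_neq continuous_intros)
    moreover have "?U \<noteq> {}"
    proof
      assume "?U = {}"
      then have "q * q' = 0"
        by (intro peval_eq_0_on_open_imp_eq_0[OF open_interior assms(4)]) auto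
      then show False using pq(2) pq'(2) by simp
    qed
    ultimately show ?thesis
    proof (rule ratfun_eqI)
      fix x assume x: "x \<in> ?U"
      then have nz: "peval q x \<noteq> 0" "peval q' x \<noteq> 0" by (auto simp: peval_mult)
      let ?I = "LINT u:K|lebesgue. exp (- (x \<bullet> u))"
      have "peval p x / peval q x = ?I"
        using ext x pq nz by (auto simp: extends_integral_def)
      then have "has_value R x ?I" using has_valueI[OF nz(1), of p] pq(1) by simp
      moreover have "peval p' x / peval q' x = ?I"
        using that x pq' nz by (auto simp: extends_integral_def)
      then have "has_value R' x ?I" using has_valueI[OF nz(2), of p'] pq'(1) by simp
      ultimately show "\<exists>r. has_value R' x r \<and> has_value R x r" by blast
    qed
  qed
  then have "(THE R. extends_integral R K) = R" using ext by (intro the_equality)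
  then show ?thesis using assms(2,3) by (simp add: cone_integral_def)
qed

subsection \<open>The sums over linear extensions as integrals\<close>

lemma prod_inverse_eq_sign:
  fixes a :: "'n::finite \<Rightarrow> real"
  shows "(\<Prod>i\<in>UNIV. inverse (a i)) = (-1) ^ card {i. a i < 0} * (\<Prod>i\<in>UNIV. 1 / \<bar>a i\<bar>)"
proof -
  have "(\<Prod>i\<in>UNIV. inverse (a i)) = (\<Prod>i\<in>UNIV. (if a i < 0 then -1 else 1) * (1 / \<bar>a i\<bar>))"
    \<comment> \<open>A zero factor is covered as well, since division by zero yields zero on both
      sides.\<close>
    by (intro prod.cong refl) (auto simp: field_simps)
  also have "\<dots> = (\<Prod>i\<in>UNIV. if a i < 0 then -1 else 1) * (\<Prod>i\<in>UNIV. 1 / \<bar>a i\<bar>)"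
    by (rule prod.distrib)
  also have "(\<Prod>i\<in>UNIV. if a i < 0 then -1 else 1) = (-1 :: real) ^ card {i. a i < 0}"
    by (simp add: prod.If_cases)
  finally show ?thesis .
qed

text \<open>Reversing the generators on which \<open>x\<close> is negative makes the integral
  converge and changes the product of inverses by one sign for each reversed generator.\<close>

lemma signed_cone_integral:
  fixes A B :: "'n::{finite,wellorder} \<Rightarrow> real^'n::_"
  assumes dual: "\<And>i j. A i \<bullet> B j = (if i = j then 1 else 0)"
    and det: "\<bar>det (\<chi> i. A i)\<bar> = 1"
    and x: "\<And>i. x \<bullet> A i \<noteq> 0"
  shows "has_bochner_integral lborel
    (\<lambda>u. (if {i. u \<bullet> B i < 0} = {i. x \<bullet> A i < 0} then (-1) ^ card {i. x \<bullet> A i < 0} else 0) * exp (- (x \<bullet> u)))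
    (\<Prod>i\<in>UNIV. inverse (x \<bullet> A i))"
proof -
  have "has_bochner_integral lborel (\<lambda>u. (-1) ^ card {i. x \<bullet> A i < 0} *
      (if {i. u \<bullet> B i < 0} = {i. x \<bullet> A i < 0} then exp (- (x \<bullet> u)) else 0))
    ((-1) ^ card {i. x \<bullet> A i < 0} * (\<Prod>i\<in>UNIV. 1 / \<bar>x \<bullet> A i\<bar>))"
    by (intro has_bochner_integral_mult_right simplicial_cone_integral assms)
  also have "(-1) ^ card {i. x \<bullet> A i < 0} * (\<Prod>i\<in>UNIV. 1 / \<bar>x \<bullet> A i\<bar>) = (\<Prod>i\<in>UNIV. inverse (x \<bullet> A i))"
    by (rule prod_inverse_eq_sign[symmetric])
  finally show ?thesis
    by (rule has_bochner_integral_cong[THEN iffD1, rotated -1]) auto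
qed

text \<open>The matrix with the weights as rows is unitriangular, and \<open>act w\<close> is
  orthogonal.\<close>

lemma det_act_weight:
  fixes w :: "'n::{finite,wellorder} \<times> bool \<Rightarrow> 'n \<times> bool"
  assumes "signed_perm w"
  shows "\<bar>det (\<chi> i. act w (weight i))\<bar> = 1"
proof -
  let ?V = "\<chi> i. weight i :: real^'n::_^'n::_"
  have "(\<chi> i. act w (weight i)) = ?V ** Finite_Cartesian_Product.transpose (matrix (act w))"
  proof -
    have "act w (weight i) $ j = (\<Sum>k\<in>UNIV. weight i $ k * matrix (act w) $ j $ k)" for i j
    proof -
      have "act w (weight i) = matrix (act w) *v weight i"
        by (simp add: linear_act)
      then show ?thesis by (simp add: matrix_vector_mult_def mult.commute)
    qed
    then show ?thesis
      by (simp add: vec_eq_iff matrix_matrix_mult_def Finite_Cartesian_Product.transpose_def)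
  qed
  moreover have "det ?V = 1"
    by (subst det_lowerdiagonal) (auto simp: weight_nth)
  moreover have "\<bar>det (matrix (act w))\<bar> = 1"
    by (rule orthogonal_transformation_det[OF orthogonal_transformation_act[OF assms]])
  ultimately show ?thesis by (simp add: det_mul det_transpose)
qed

lemma det_act_simple_root:
  fixes w :: "'n::{finite,wellorder} \<times> bool \<Rightarrow> 'n \<times> bool"
  assumes "signed_perm w"
  shows "\<bar>det (\<chi> i. act w (simple_root i))\<bar> = 1"
proof -
  have "(\<chi> i. act w (simple_root i)) ** Finite_Cartesian_Product.transpose (\<chi> i. act w (weight i))
      = (mat 1 :: real^'n::_^'n::_)"
    using act_root_inner_weight[OF assms]
    by (simp add: vec_eq_iff matrix_matrix_mult_def Finite_Cartesian_Product.transpose_def mat_def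
        inner_vec_def)
  then have "det (\<chi> i. act w (simple_root i)) * det (\<chi> i. act w (weight i)) = 1"
    by (metis det_I det_mul det_transpose)
  then show ?thesis using det_act_weight[OF assms] by (metis abs_mult abs_one mult.right_neutral)
qed

lemma Psi_sum_integral:
  assumes "regular x"
  shows "has_bochner_integral lborel (\<lambda>u. signed_count P x u * exp (- (x \<bullet> u)))
    (\<Sum>w\<in>linear_extensions P. \<Prod>i\<in>UNIV. inverse (x \<bullet> act w (simple_root i)))"
proof -
  have "has_bochner_integral lborel (\<lambda>u. (if neg_roots w x = neg_weights w u
        then (-1) ^ card (neg_roots w x) else 0) * exp (- (x \<bullet> u)))
      (\<Prod>i\<in>UNIV. inverse (x \<bullet> act w (simple_root i)))" if "w \<in> linear_extensions P" for w
  proof -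
    have w: "signed_perm w" using that by (rule linear_extension_signed_perm)
    show ?thesis
      using signed_cone_integral[OF act_root_inner_weight[OF w] det_act_simple_root[OF w], of x]
        regular_act_simple_root[OF assms w]
      by (simp add: neg_roots_def neg_weights_def eq_commute[of "{i. x \<bullet> _ i < 0}"] cong: if_cong)
  qed
  then show ?thesis
    unfolding signed_count_def sum_distrib_right by (rule has_bochner_integral_sum)
qed

text \<open>Roots and weights exchange roles: \<open>x\<close> now enters through
  \<open>neg_weights\<close>. The sign may still be read off \<open>neg_roots\<close>, since the two
  sets agree where the summand is nonzero.\<close>

lemma Phi_sum_integral:
  assumes "\<And>w i. w \<in> linear_extensions P \<Longrightarrow> x \<bullet> act w (weight i) \<noteq> 0"
  shows "has_bochner_integral lborel (\<lambda>u. signed_count P u x * exp (- (x \<bullet> u)))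
    (\<Sum>w\<in>linear_extensions P. \<Prod>i\<in>UNIV. inverse (x \<bullet> act w (weight i)))"
proof -
  have "has_bochner_integral lborel (\<lambda>u. (if neg_roots w u = neg_weights w x
        then (-1) ^ card (neg_roots w u) else 0) * exp (- (x \<bullet> u)))
      (\<Prod>i\<in>UNIV. inverse (x \<bullet> act w (weight i)))" if "w \<in> linear_extensions P" for w
  proof -
    have w: "signed_perm w" using that by (rule linear_extension_signed_perm)
    have dual: "act w (weight i) \<bullet> act w (simple_root j) = (if i = j then 1 else 0)" for i j
      using act_root_inner_weight[OF w, of j i] by (simp add: inner_commute)
    show ?thesis
      using signed_cone_integral[OF dual det_act_weight[OF w], of x] assms[OF that]
      by (simp add: neg_roots_def neg_weights_def cong: if_cong)
  qed
  then show ?thesis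
    unfolding signed_count_def sum_distrib_right by (rule has_bochner_integral_sum)
qed

lemma has_value_Psi:
  assumes "regular x"
  shows "has_value (Psi P) x (\<Sum>w\<in>linear_extensions P. \<Prod>i\<in>UNIV. inverse (x \<bullet> act w (simple_root i)))"
  unfolding Psi_def
  by (intro has_value_sum has_value_prod has_value_inverse has_value_lin_form
      regular_act_simple_root[OF assms] linear_extension_signed_perm)

lemma has_value_Phi:
  assumes "\<And>w i. w \<in> linear_extensions P \<Longrightarrow> x \<bullet> act w (weight i) \<noteq> 0"
  shows "has_value (Phi P) x (\<Sum>w\<in>linear_extensions P. \<Prod>i\<in>UNIV. inverse (x \<bullet> act w (weight i)))"
  unfolding Phi_def
  by (intro has_value_sum has_value_prod has_value_inverse has_value_lin_form assms)

text \<open>The rays of all chambers. Off their orthogonal hyperplanes no denominator in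
  \<open>Phi P\<close> vanishes, whatever \<open>P\<close> is.\<close>

definition weight_orbit :: "(real^'n::{finite,wellorder}) set" where
  "weight_orbit = {act w (weight i) | w i. signed_perm w}"

lemma finite_weight_orbit: "finite weight_orbit"
proof -
  have "weight_orbit \<subseteq> (\<lambda>(w, i). act w (weight i)) ` UNIV" by (auto simp: weight_orbit_def)
  then show ?thesis by (rule finite_subset) simp
qed

lemma zero_notin_weight_orbit: "(0 :: real^'n::{finite,wellorder}) \<notin> weight_orbit"
proof
  assume "(0 :: real^'n::_) \<in> weight_orbit"
  then obtain w and i :: 'n where "signed_perm w" "(0 :: real^'n::_) = act w (weight i)"
    unfolding weight_orbit_def by blast
  then show False using act_root_inner_weight[of w i i] by simp
qed

section \<open>The dual sums as constant multiples of the primal ones\<close>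

lemma has_value_half: "has_value (1 / 2) x (1 / 2)"
  using has_value_inverse[OF has_value_add[OF has_value_1 has_value_1], of x]
  by (simp add: inverse_eq_divide)

lemma has_value_2: "has_value 2 x 2"
  using has_value_add[OF has_value_1 has_value_1, of x] by simp

lemma prod_inverse_scale_last:
  fixes a :: "'n::{finite,wellorder} \<Rightarrow> real"
  shows "(\<Prod>i\<in>UNIV. inverse ((if i = last_index then c else 1) * a i)) = inverse c * (\<Prod>i\<in>UNIV. inverse (a i))"
proof -
  have "(\<Prod>i\<in>UNIV. inverse ((if i = last_index then c else 1) * a i))
      = (\<Prod>i\<in>UNIV. (if i = last_index then inverse c else 1) * inverse (a i))"
    by (intro prod.cong refl) auto
  then show ?thesis by (simp add: prod.distrib)
qed

text \<open>Both sums run over the same linear extensions. Only the last simple coroot differs from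
  the simple root, by the factor 2, so every product is halved; regular points suffice for the
  comparison.\<close>

lemma Psi_dual_eq: "Psi_dual (dual_poset P) = 1 / 2 * Psi P"
proof -
  have "open {x :: real^'a::_. \<forall>h\<in>roots_B. x \<bullet> h \<noteq> 0}"
    by (rule open_off_hyperplanes[OF finite_roots_B])
  moreover have "{x :: real^'a::_. \<forall>h\<in>roots_B. x \<bullet> h \<noteq> 0} \<noteq> {}"
    using off_hyperplanes_nonempty[OF finite_roots_B zero_notin_roots_B open_UNIV UNIV_not_empty] by simp
  ultimately show ?thesis
  proof (rule ratfun_eqI)
    fix x :: "real^'a::_" assume "x \<in> {x. \<forall>h\<in>roots_B. x \<bullet> h \<noteq> 0}"
    then have x: "regular x" by (simp add: regular_def)
    let ?r = "\<Sum>w\<in>linear_extensions P. \<Prod>i\<in>UNIV. inverse (x \<bullet> act w (simple_root i))"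
    have "has_value (Psi_dual (dual_poset P)) x
        (\<Sum>w\<in>linear_extensions P. \<Prod>i\<in>UNIV. inverse (x \<bullet> act w (simple_coroot i)))"
      unfolding Psi_dual_def coroot_vimage_dual_poset
    proof (intro has_value_sum has_value_prod has_value_inverse has_value_lin_form)
      fix w i assume "w \<in> linear_extensions P"
      then show "x \<bullet> act w (simple_coroot i) \<noteq> 0"
        using regular_act_simple_root[OF x linear_extension_signed_perm]
        by (simp add: simple_coroot_eq act_scaleR)
    qed
    also have "(\<Sum>w\<in>linear_extensions P. \<Prod>i\<in>UNIV. inverse (x \<bullet> act w (simple_coroot i))) = 1 / 2 * ?r"
      unfolding simple_coroot_eq act_scaleR inner_scaleR_right prod_inverse_scale_last
      by (simp add: sum_distrib_left)
    finally show "\<exists>r. has_value (Psi_dual (dual_poset P)) x r \<and> has_value (1 / 2 * Psi P) x r"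
      using has_value_mult[OF has_value_half has_value_Psi[OF x]] by blast
  qed
qed

lemma Phi_dual_eq: "Phi_dual (dual_poset P) = 2 * Phi P"
proof -
  have "open {x :: real^'a::_. \<forall>h\<in>weight_orbit. x \<bullet> h \<noteq> 0}"
    by (rule open_off_hyperplanes[OF finite_weight_orbit])
  moreover have "{x :: real^'a::_. \<forall>h\<in>weight_orbit. x \<bullet> h \<noteq> 0} \<noteq> {}"
    using off_hyperplanes_nonempty[OF finite_weight_orbit zero_notin_weight_orbit open_UNIV UNIV_not_empty] by simp
  ultimately show ?thesis
  proof (rule ratfun_eqI)
    fix x :: "real^'a::_" assume "x \<in> {x. \<forall>h\<in>weight_orbit. x \<bullet> h \<noteq> 0}"
    then have x: "x \<bullet> act w (weight i) \<noteq> 0" if "w \<in> linear_extensions P" for w i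
      using linear_extension_signed_perm[OF that] by (auto simp: weight_orbit_def)
    let ?r = "\<Sum>w\<in>linear_extensions P. \<Prod>i\<in>UNIV. inverse (x \<bullet> act w (weight i))"
    have "has_value (Phi_dual (dual_poset P)) x
        (\<Sum>w\<in>linear_extensions P. \<Prod>i\<in>UNIV. inverse (x \<bullet> act w (coweight i)))"
      unfolding Phi_dual_def coroot_vimage_dual_poset
    proof (intro has_value_sum has_value_prod has_value_inverse has_value_lin_form)
      fix w i assume "w \<in> linear_extensions P"
      then show "x \<bullet> act w (coweight i) \<noteq> 0"
        using x by (simp add: coweight_eq act_scaleR)
    qed
    also have "(\<Sum>w\<in>linear_extensions P. \<Prod>i\<in>UNIV. inverse (x \<bullet> act w (coweight i))) = 2 * ?r"
      unfolding coweight_eq act_scaleR inner_scaleR_right prod_inverse_scale_last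
      by (simp add: sum_distrib_left)
    finally show "\<exists>r. has_value (Phi_dual (dual_poset P)) x r \<and> has_value (2 * Phi P) x r"
      using has_value_mult[OF has_value_2 has_value_Phi[OF x]] by blast
  qed
qed

section \<open>Almost everywhere statements and Lebesgue measure\<close>

lemma AE_regular: "AE u in lebesgue. regular (u :: real^'n::{finite,wellorder})"
proof -
  have "negligible (\<Union>h\<in>roots_B. {u :: real^'n::_. h \<bullet> u = 0})"
    using zero_notin_roots_B by (intro negligible_Union) (auto simp: finite_roots_B intro!: negligible_hyperplane)
  then have "(\<Union>h\<in>roots_B. {u :: real^'n::_. h \<bullet> u = 0}) \<in> null_sets lebesgue"
    by (simp add: negligible_iff_null_sets)
  then show ?thesis
    by (rule AE_I') (auto simp: regular_def inner_commute)
qed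

lemma has_bochner_integral_lebesgue:
  fixes f :: "'a::euclidean_space \<Rightarrow> real"
  assumes "has_bochner_integral lborel f I"
  shows "has_bochner_integral lebesgue f I"
proof -
  have f: "f \<in> borel_measurable lborel" "integrable lborel f" "integral\<^sup>L lborel f = I"
    using assms by (auto simp: has_bochner_integral_iff)
  then show ?thesis
    using integrable_completion[OF f(1)] integral_completion[OF f(1)] by (simp add: has_bochner_integral_iff)
qed

lemma set_lebesgue_integralI:
  assumes "has_bochner_integral lborel (\<lambda>u. g u * exp (- (x \<bullet> u))) I"
    and "K \<in> sets lebesgue" and ae: "AE u in lebesgue. g u = indicator K u"
  shows "set_integrable lebesgue K (\<lambda>u. exp (- (x \<bullet> u)))" "(LINT u:K|lebesgue. exp (- (x \<bullet> u))) = I"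
proof -
  have 1: "has_bochner_integral lebesgue (\<lambda>u. g u * exp (- (x \<bullet> u))) I"
    by (rule has_bochner_integral_lebesgue[OF assms(1)])
  have e: "(\<lambda>u. exp (- (x \<bullet> u))) \<in> borel_measurable lebesgue"
    by (intro measurable_completion) simp
  have "has_bochner_integral lebesgue (\<lambda>u. indicator K u *\<^sub>R exp (- (x \<bullet> u))) I"
  proof (rule has_bochner_integral_cong_AE[THEN iffD1, OF _ _ _ 1])
    show "(\<lambda>u. g u * exp (- (x \<bullet> u))) \<in> borel_measurable lebesgue"
      using 1 by (auto simp: has_bochner_integral_iff)
    show "(\<lambda>u. indicator K u *\<^sub>R exp (- (x \<bullet> u))) \<in> borel_measurable lebesgue"
      using assms(2) e by measurable
    show "AE u in lebesgue. g u * exp (- (x \<bullet> u)) = indicator K u *\<^sub>R exp (- (x \<bullet> u))"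
      using ae by eventually_elim simp
  qed
  then show "set_integrable lebesgue K (\<lambda>u. exp (- (x \<bullet> u)))" "(LINT u:K|lebesgue. exp (- (x \<bullet> u))) = I"
    by (auto simp: has_bochner_integral_iff set_integrable_def set_lebesgue_integral_def)
qed

subsection \<open>The cones of a signed poset\<close>

lemma root_cone_minimal:
  assumes "P \<subseteq> C" "convex_cone C"
  shows "root_cone P \<subseteq> C"
  unfolding root_cone_def using assms by (rule hull_minimal)

lemma convex_coneI:
  assumes "0 \<in> C" "\<And>x y. x \<in> C \<Longrightarrow> y \<in> C \<Longrightarrow> x + y \<in> C" "\<And>c x. c \<ge> 0 \<Longrightarrow> x \<in> C \<Longrightarrow> c *\<^sub>R x \<in> C"
  shows "convex_cone C"
  using assms by (auto simp: convex_cone_def convex_def conic_def)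

lemma subset_root_cone: "P \<subseteq> root_cone P"
  by (simp add: root_cone_def hull_subset)

lemma zero_in_root_cone: "0 \<in> root_cone P"
  by (simp add: root_cone_def convex_cone_hull_contains_0)

lemma root_cone_add: "x \<in> root_cone P \<Longrightarrow> y \<in> root_cone P \<Longrightarrow> x + y \<in> root_cone P"
  by (simp add: root_cone_def convex_cone_hull_add)

lemma root_cone_scaleR: "x \<in> root_cone P \<Longrightarrow> c \<ge> 0 \<Longrightarrow> c *\<^sub>R x \<in> root_cone P"
  by (simp add: root_cone_def convex_cone_hull_mul)

lemma convex_root_cone: "convex (root_cone P)"
  by (simp add: root_cone_def convex_convex_cone_hull)

lemma dual_root_cone: "dual_cone (root_cone P) = weight_cone P"
proof
  show "dual_cone (root_cone P) \<subseteq> weight_cone P"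
    using subset_root_cone by (auto simp: dual_cone_def weight_cone_def)
  show "weight_cone P \<subseteq> dual_cone (root_cone P)"
  proof
    fix x assume "x \<in> weight_cone P"
    then have "root_cone P \<subseteq> {u. x \<bullet> u \<ge> 0}"
      by (intro root_cone_minimal convex_coneI) (auto simp: weight_cone_def inner_add_right)
    then show "x \<in> dual_cone (root_cone P)" by (auto simp: dual_cone_def)
  qed
qed

lemma root_cone_subset_dual_weight_cone: "root_cone P \<subseteq> dual_cone (weight_cone P)"
  unfolding dual_root_cone[symmetric] by (auto simp: dual_cone_def inner_commute)

lemma closed_weight_cone: "closed (weight_cone P)"
proof -
  have "weight_cone P = (\<Inter>\<alpha>\<in>P. {f. f \<bullet> \<alpha> \<ge> 0})" by (auto simp: weight_cone_def)
  then show ?thesis by (auto intro!: closed_INT closed_Collect_le continuous_intros)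
qed

text \<open>Farkas' lemma. A hyperplane separates \<open>u\<close> from the closed cone; its level
  \<open>b\<close> is negative because the cone contains 0, and a functional bounded below on a cone
  is nonnegative there.\<close>

lemma separation_from_root_cone:
  assumes "finite P" "u \<notin> root_cone P"
  obtains a where "a \<in> weight_cone P" "a \<bullet> u < 0"
proof -
  have "closed (root_cone P)" using assms(1) by (simp add: root_cone_def closed_convex_cone_hull)
  then obtain a b where ab: "a \<bullet> u < b" "\<And>y. y \<in> root_cone P \<Longrightarrow> a \<bullet> y > b"
    using separating_hyperplane_closed_point[OF convex_root_cone _ assms(2)] by blast
  have "b < 0" using ab(2)[OF zero_in_root_cone] by simp
  have "a \<bullet> \<alpha> \<ge> 0" if "\<alpha> \<in> P" for \<alpha>
  proof (rule ccontr)
    assume "\<not> a \<bullet> \<alpha> \<ge> 0"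
    then have neg: "a \<bullet> \<alpha> < 0" by simp
    \<comment> \<open>This multiple of the generator lies in the cone and has value exactly
      \<open>b\<close>, against the strict bound.\<close>
    have "b / (a \<bullet> \<alpha>) \<ge> 0" using neg \<open>b < 0\<close> by (simp add: divide_nonpos_neg)
    then have "(b / (a \<bullet> \<alpha>)) *\<^sub>R \<alpha> \<in> root_cone P"
      using that subset_root_cone by (blast intro: root_cone_scaleR)
    then have "a \<bullet> ((b / (a \<bullet> \<alpha>)) *\<^sub>R \<alpha>) > b" by (rule ab(2))
    then show False using neg by simp
  qed
  then show thesis using that ab(1) \<open>b < 0\<close> by (force simp: weight_cone_def)
qed

section \<open>Geometry of the cones of a fixed signed poset\<close>

context
  fixes P :: "(real^'n::{finite,wellorder}) set"
  assumes P: "signed_poset P"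
begin

lemma signed_poset_roots: "P \<subseteq> roots_B"
  using P by (simp add: signed_poset_def)

lemma finite_signed_poset: "finite P"
  using signed_poset_roots finite_roots_B by (rule finite_subset)

text \<open>Separate 0 from the convex hull of \<open>P\<close>. Were 0 a convex combination,
  solving for a root with positive coefficient would put its negative into the root cone, hence into
  \<open>P\<close> by saturation, which antisymmetry forbids.\<close>

lemma exists_positive_functional:
  obtains f where "\<And>\<alpha>. \<alpha> \<in> P \<Longrightarrow> f \<bullet> \<alpha> > 0"
proof -
  have "0 \<notin> convex hull P"
  proof
    assume "0 \<in> convex hull P"
    then obtain c where c: "\<And>\<alpha>. \<alpha> \<in> P \<Longrightarrow> 0 \<le> c \<alpha>" "sum c P = 1" "(\<Sum>\<alpha>\<in>P. c \<alpha> *\<^sub>R \<alpha>) = 0"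
      unfolding convex_hull_finite[OF finite_signed_poset] by auto
    have "\<exists>\<alpha>\<in>P. c \<alpha> \<noteq> 0" using c(2) by (metis sum.neutral zero_neq_one)
    then obtain \<alpha> where \<alpha>: "\<alpha> \<in> P" "c \<alpha> > 0" using c(1) by force
    have sum_in: "(\<Sum>\<beta>\<in>I. c \<beta> *\<^sub>R \<beta>) \<in> root_cone P" if "I \<subseteq> P" for I
      using finite_subset[OF that finite_signed_poset] that
    proof (induction I rule: finite_induct)
      case (insert \<beta> I)
      then show ?case
        using c(1) subset_root_cone[of P] by (auto intro!: root_cone_add root_cone_scaleR)
    qed (simp add: zero_in_root_cone)
    have "(\<Sum>\<beta>\<in>P - {\<alpha>}. c \<beta> *\<^sub>R \<beta>) = - (c \<alpha> *\<^sub>R \<alpha>)"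
      using c(3) \<alpha>(1) finite_signed_poset by (simp add: sum.remove[of P \<alpha>] eq_neg_iff_add_eq_0 add.commute)
    then have "inverse (c \<alpha>) *\<^sub>R - (c \<alpha> *\<^sub>R \<alpha>) \<in> root_cone P"
      using sum_in[of "P - {\<alpha>}"] \<alpha>(2) by (intro root_cone_scaleR) auto
    then have "- \<alpha> \<in> root_cone P" using \<alpha>(2) by simp
    moreover have "- \<alpha> \<in> roots_B"
    proof -
      have "\<alpha> \<in> roots_B" using \<alpha>(1) signed_poset_roots by blast
      then show ?thesis
        using roots_B_uminus by blast
    qed
    ultimately have "- \<alpha> \<in> P" using P by (auto simp: signed_poset_def)
    then show False using P \<alpha>(1) by (auto simp: signed_poset_def)
  qed
  moreover have "closed (convex hull P)"
    using finite_signed_poset by (intro compact_imp_closed finite_imp_compact_convex_hull)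
  ultimately obtain f b where "b > 0" "\<And>y. y \<in> convex hull P \<Longrightarrow> f \<bullet> y > b"
    using separating_hyperplane_closed_0[of "convex hull P"] by auto
  then have "f \<bullet> \<alpha> > 0" if "\<alpha> \<in> P" for \<alpha>
    using hull_inc[OF that, of convex] by fastforce
  then show thesis by (rule that)
qed

lemma interior_weight_cone: "interior (weight_cone P) \<noteq> {}"
proof -
  obtain f where f: "\<And>\<alpha>. \<alpha> \<in> P \<Longrightarrow> f \<bullet> \<alpha> > 0" using exists_positive_functional by metis
  have "open (\<Inter>\<alpha>\<in>P. {f. f \<bullet> \<alpha> > 0})"
    by (intro open_INT finite_signed_poset ballI open_Collect_less continuous_intros)
  moreover have "(\<Inter>\<alpha>\<in>P. {f. f \<bullet> \<alpha> > 0}) \<subseteq> weight_cone P"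
    by (force simp: weight_cone_def)
  ultimately have "f \<in> interior (weight_cone P)" using f by (intro interiorI) auto
  then show ?thesis by blast
qed

lemma pointed_root_cone: "pointed (root_cone P)"
proof -
  obtain f where f: "\<And>\<alpha>. \<alpha> \<in> P \<Longrightarrow> f \<bullet> \<alpha> > 0" using exists_positive_functional by metis
  \<comment> \<open>An open half-space together with 0 is a convex cone without lines.\<close>
  have sub: "root_cone P \<subseteq> {u. u = 0 \<or> f \<bullet> u > 0}"
  proof (intro root_cone_minimal convex_coneI)
    fix c :: real and u assume "c \<ge> 0" "u \<in> {u. u = 0 \<or> f \<bullet> u > 0}"
    then show "c *\<^sub>R u \<in> {u. u = 0 \<or> f \<bullet> u > 0}" by (cases "c = 0") auto
  qed (use f in \<open>auto simp: inner_add_right\<close>)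
  have "u = 0" if "u \<in> root_cone P" "- u \<in> root_cone P" for u
    using subsetD[OF sub that(1)] subsetD[OF sub that(2)] by auto
  then show ?thesis unfolding pointed_def by auto
qed

lemma full_dimensional_weight_cone: "full_dimensional (weight_cone P)"
  using interior_weight_cone by (simp add: full_dimensional_def aff_dim_nonempty_interior)

text \<open>Without interior, the root cone would lie in a hyperplane through 0, and the line
  spanned by its normal would lie in the weight cone.\<close>

lemma interior_dual_weight_cone:
  assumes "pointed (weight_cone P)"
  shows "interior (dual_cone (weight_cone P)) \<noteq> {}"
proof -
  have "interior (root_cone P) \<noteq> {}"
  proof
    assume "interior (root_cone P) = {}"
    then obtain v b where v: "v \<noteq> 0" "root_cone P \<subseteq> {x. v \<bullet> x = b}"
      using empty_interior_subset_hyperplane[OF convex_root_cone] by metis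
    then have "b = 0" using zero_in_root_cone[of P] by auto
    then have "v \<bullet> \<alpha> = 0" if "\<alpha> \<in> P" for \<alpha> using v(2) subset_root_cone that by blast
    then have "v \<in> weight_cone P" "- v \<in> weight_cone P" by (auto simp: weight_cone_def)
    then have "v \<in> weight_cone P \<inter> uminus ` weight_cone P" by (metis IntI image_eqI minus_minus)
    then show False using assms v(1) by (auto simp: pointed_def)
  qed
  then show ?thesis using interior_mono[OF root_cone_subset_dual_weight_cone] by blast
qed

text \<open>Inside the root cone all pairings of \<open>u\<close> with rays of linear extensions are
  nonnegative, and \<open>signed_count_eq_indicator\<close> applies. Outside, Farkas gives
  \<open>a\<close> in the weight cone that is negative on \<open>u\<close>; \<open>x\<close> can be
  moved close to \<open>a\<close> without changing signs on \<open>P\<close>, and there the count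
  vanishes.\<close>

lemma signed_count_eq_indicator_root_cone:
  assumes x: "x \<in> weight_cone P" "regular x"
  shows "signed_count P x u = indicator (root_cone P) u"
proof (cases "u \<in> root_cone P")
  case True
  have "root_cone P \<subseteq> {u. u \<bullet> act w (weight i) \<ge> 0}" if "w \<in> linear_extensions P" for w i
    using linear_extension_inner_weight[OF that]
    by (intro root_cone_minimal convex_coneI) (auto simp: inner_add_left)
  then have "signed_count P x u = indicator (weight_cone P) x"
    using True by (intro signed_count_eq_indicator signed_poset_roots x(2)) blast
  then show ?thesis using x(1) True by simp
next
  case False
  have pos: "x \<bullet> \<alpha> > 0" if "\<alpha> \<in> P" for \<alpha>
    using x that signed_poset_roots by (force simp: weight_cone_def regular_def less_le)
  obtain a where a: "a \<in> weight_cone P" "a \<bullet> u < 0"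
    using separation_from_root_cone[OF finite_signed_poset False] by blast
  \<comment> \<open>A small positive multiple of \<open>x\<close> makes \<open>a\<close> regular and
    strictly positive on \<open>P\<close>, and keeps it negative on \<open>u\<close>.\<close>
  have "\<forall>\<^sub>F e in at 0. \<forall>h\<in>roots_B. (a + e *\<^sub>R x) \<bullet> h \<noteq> 0"
    using x(2) by (intro eventually_off_hyperplanes finite_roots_B) (auto simp: regular_def)
  then have 1: "\<forall>\<^sub>F e in at_right 0. \<forall>h\<in>roots_B. (a + e *\<^sub>R x) \<bullet> h \<noteq> 0"
    by (rule filter_leD[OF at_le, rotated]) simp
  have "((\<lambda>e. (a + e *\<^sub>R x) \<bullet> u) \<longlongrightarrow> (a + 0 *\<^sub>R x) \<bullet> u) (at_right 0)" by (intro tendsto_intros)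
  then have 2: "\<forall>\<^sub>F e in at_right 0. (a + e *\<^sub>R x) \<bullet> u < 0"
    using a(2) by (auto dest: order_tendstoD(2))
  have 3: "\<forall>\<^sub>F e in at_right (0::real). e > 0" by (simp add: eventually_at_filter)
  obtain e where e: "\<forall>h\<in>roots_B. (a + e *\<^sub>R x) \<bullet> h \<noteq> 0" "(a + e *\<^sub>R x) \<bullet> u < 0" "e > 0"
    using eventually_happens'[OF trivial_limit_at_right_real eventually_conj[OF 1 eventually_conj[OF 2 3]]]
    by blast
  have "signed_count P x u = signed_count P (a + e *\<^sub>R x) u"
  proof (rule signed_count_cong[OF signed_poset_roots x(2)])
    show "regular (a + e *\<^sub>R x)" using e(1) by (simp add: regular_def)
    fix \<alpha> assume \<alpha>: "\<alpha> \<in> P"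
    then have "a \<bullet> \<alpha> \<ge> 0" using a(1) by (simp add: weight_cone_def)
    then have "(a + e *\<^sub>R x) \<bullet> \<alpha> > 0"
      using pos[OF \<alpha>] e(3) by (simp add: inner_add_left add_nonneg_pos)
    then show "0 < x \<bullet> \<alpha> \<longleftrightarrow> 0 < (a + e *\<^sub>R x) \<bullet> \<alpha>" using pos[OF \<alpha>] by simp
  qed
  also have "\<dots> = 0" by (rule signed_count_eq_0[OF e(2)])
  finally show ?thesis using False by simp
qed

text \<open>Moving \<open>u\<close> along the line leaves its signs on \<open>P\<close> unchanged and makes its product with
  \<open>x\<close> negative.\<close>

lemma signed_count_eq_0_of_line:
  assumes v: "\<And>\<alpha>. \<alpha> \<in> P \<Longrightarrow> v \<bullet> \<alpha> = 0" and xv: "x \<bullet> v \<noteq> 0" and u: "regular u"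
  shows "signed_count P u x = 0"
proof -
  \<comment> \<open>The coefficient is chosen so that the pairing with \<open>x\<close> becomes
    -1.\<close>
  define y where "y = u - ((u \<bullet> x + 1) / (v \<bullet> x)) *\<^sub>R v"
  have yx: "y \<bullet> x = -1" using xv by (simp add: y_def inner_diff_left inner_commute[of x v])
  \<comment> \<open>The shifted vector may have lost regularity. Roots orthogonal to
    \<open>v\<close> keep their nonzero value at \<open>u\<close>, and a further small shift along
    \<open>v\<close> avoids the hyperplanes of the others.\<close>
  have "\<forall>\<^sub>F e in at 0. \<forall>h\<in>{h \<in> roots_B. v \<bullet> h \<noteq> 0}. (y + e *\<^sub>R v) \<bullet> h \<noteq> 0"
    by (intro eventually_off_hyperplanes) (auto simp: finite_roots_B)
  moreover have "\<forall>\<^sub>F e in at 0. (y + e *\<^sub>R v) \<bullet> x < 0"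
  proof -
    have "((\<lambda>e. (y + e *\<^sub>R v) \<bullet> x) \<longlongrightarrow> (y + 0 *\<^sub>R v) \<bullet> x) (at 0)" by (intro tendsto_intros)
    then show ?thesis using yx by (auto dest: order_tendstoD(2)[where a = 0])
  qed
  ultimately have "\<forall>\<^sub>F e in at 0. (\<forall>h\<in>{h \<in> roots_B. v \<bullet> h \<noteq> 0}. (y + e *\<^sub>R v) \<bullet> h \<noteq> 0)
      \<and> (y + e *\<^sub>R v) \<bullet> x < 0" by (rule eventually_conj)
  then obtain e where e: "\<forall>h\<in>{h \<in> roots_B. v \<bullet> h \<noteq> 0}. (y + e *\<^sub>R v) \<bullet> h \<noteq> 0" "(y + e *\<^sub>R v) \<bullet> x < 0"
    using eventually_happens'[of "at (0::real)"] by (metis (mono_tags, lifting) at_neq_bot)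
  have same: "(y + e *\<^sub>R v) \<bullet> h = u \<bullet> h" if "v \<bullet> h = 0" for h
    using that by (simp add: y_def inner_add_left inner_diff_left)
  have "signed_count P u x = signed_count P (y + e *\<^sub>R v) x"
  proof (rule signed_count_cong[OF signed_poset_roots u])
    show "regular (y + e *\<^sub>R v)"
      unfolding regular_def using e(1) same u by (metis (mono_tags, lifting) mem_Collect_eq regular_def)
  qed (simp add: same v)
  also have "\<dots> = 0" by (rule signed_count_eq_0[OF e(2)])
  finally show ?thesis .
qed

section \<open>Comparison with the cone integrals\<close>

lemma Psi_value_integral:
  assumes x: "x \<in> weight_cone P" "regular x"
  shows "set_integrable lebesgue (root_cone P) (\<lambda>u. exp (- (x \<bullet> u)))"
    "has_value (Psi P) x (LINT u:root_cone P|lebesgue. exp (- (x \<bullet> u)))"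
proof -
  have "closed (root_cone P)"
    by (simp add: root_cone_def closed_convex_cone_hull finite_signed_poset)
  then have "root_cone P \<in> sets lebesgue" by simp
  note * = set_lebesgue_integralI[OF Psi_sum_integral[OF x(2), of P] this]
  show "set_integrable lebesgue (root_cone P) (\<lambda>u. exp (- (x \<bullet> u)))"
    by (rule *(1)) (simp add: signed_count_eq_indicator_root_cone x)
  have "(LINT u:root_cone P|lebesgue. exp (- (x \<bullet> u)))
      = (\<Sum>w\<in>linear_extensions P. \<Prod>i\<in>UNIV. inverse (x \<bullet> act w (simple_root i)))"
    by (rule *(2)) (simp add: signed_count_eq_indicator_root_cone x)
  then show "has_value (Psi P) x (LINT u:root_cone P|lebesgue. exp (- (x \<bullet> u)))"
    using has_value_Psi[OF x(2), of P] by simp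
qed

lemma Psi_eq_cone_integral: "Psi P = cone_integral (root_cone P)"
proof (cases "full_dimensional (root_cone P)")
  case True
  have "cone_integral (root_cone P) = Psi P"
  proof (rule cone_integral_eqI[OF _ pointed_root_cone True _ finite_roots_B zero_notin_roots_B])
    show "closed (root_cone P)"
      by (simp add: root_cone_def closed_convex_cone_hull finite_signed_poset)
    show "interior (dual_cone (root_cone P)) \<noteq> {}"
      by (simp add: dual_root_cone interior_weight_cone)
    fix x assume "x \<in> interior (dual_cone (root_cone P))" "\<And>h. h \<in> roots_B \<Longrightarrow> x \<bullet> h \<noteq> 0"
    then have "x \<in> weight_cone P" "regular x"
      using interior_subset by (auto simp: dual_root_cone regular_def)
    then show "set_integrable lebesgue (root_cone P) (\<lambda>u. exp (- (x \<bullet> u))) \<and>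
        has_value (Psi P) x (LINT u:root_cone P|lebesgue. exp (- (x \<bullet> u)))"
      using Psi_value_integral by blast
  qed
  then show ?thesis by simp
next
  case False
  \<comment> \<open>A lower-dimensional root cone is a null set, so the integral representing
    \<open>Psi P\<close> vanishes, in agreement with the value 0 prescribed for
    \<open>cone_integral\<close>.\<close>
  have "interior (root_cone P) = {}"
    using False aff_dim_nonempty_interior[of "root_cone P"] by (auto simp: full_dimensional_def)
  then have "negligible (root_cone P)" by (simp add: negligible_convex_interior convex_root_cone)
  then have null: "root_cone P \<in> null_sets lebesgue" by (simp add: negligible_iff_null_sets)
  have "Psi P = 0"
  proof (rule ratfun_eqI)
    let ?U = "interior (weight_cone P) \<inter> {x. \<forall>h\<in>roots_B. x \<bullet> h \<noteq> 0}"
    show "open ?U" by (intro open_Int open_interior open_off_hyperplanes finite_roots_B)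
    show "?U \<noteq> {}"
      by (rule off_hyperplanes_nonempty[OF finite_roots_B zero_notin_roots_B open_interior interior_weight_cone])
    fix x assume "x \<in> ?U"
    then have "x \<in> weight_cone P" "regular x"
      using interior_subset by (auto simp: regular_def)
    then have "has_value (Psi P) x (LINT u:root_cone P|lebesgue. exp (- (x \<bullet> u)))"
      by (rule Psi_value_integral)
    moreover have "(LINT u:root_cone P|lebesgue. exp (- (x \<bullet> u))) = 0"
      unfolding set_lebesgue_integral_def
      using AE_not_in[OF null] by (intro integral_eq_zero_AE) (auto simp: indicator_def)
    ultimately show "\<exists>r. has_value (Psi P) x r \<and> has_value 0 x r"
      using has_value_0 by metis
  qed
  then show ?thesis using False by (simp add: cone_integral_def)
qed

lemma Phi_eq_cone_integral: "Phi P = cone_integral (weight_cone P)"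
proof (cases "pointed (weight_cone P)")
  case True
  have "cone_integral (weight_cone P) = Phi P"
  proof (rule cone_integral_eqI[OF closed_weight_cone True full_dimensional_weight_cone
        interior_dual_weight_cone[OF True] finite_weight_orbit zero_notin_weight_orbit])
    fix x assume x: "x \<in> interior (dual_cone (weight_cone P))" "\<And>h. h \<in> weight_orbit \<Longrightarrow> x \<bullet> h \<noteq> 0"
    have nz: "x \<bullet> act w (weight i) \<noteq> 0" if "w \<in> linear_extensions P" for w i
      using x(2) linear_extension_signed_perm[OF that] by (auto simp: weight_orbit_def)
    have nonneg: "x \<bullet> act w (weight i) \<ge> 0" if "w \<in> linear_extensions P" for w i
    proof -
      have "act w (weight i) \<in> weight_cone P"
        using linear_extension_inner_weight[OF that] by (simp add: weight_cone_def inner_commute)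
      then show ?thesis using x(1) interior_subset by (auto simp: dual_cone_def)
    qed
    \<comment> \<open>The variable of integration is now the first argument of the count, so
      regularity holds only almost everywhere.\<close>
    have "AE u in lebesgue. signed_count P u x = indicator (weight_cone P) u"
      using AE_regular
      by eventually_elim (intro signed_count_eq_indicator signed_poset_roots nonneg)
    note set_lebesgue_integralI[OF Phi_sum_integral[OF nz] _ this]
    then show "set_integrable lebesgue (weight_cone P) (\<lambda>u. exp (- (x \<bullet> u))) \<and>
        has_value (Phi P) x (LINT u:weight_cone P|lebesgue. exp (- (x \<bullet> u)))"
      using has_value_Phi[OF nz] closed_weight_cone[of P] by simp
  qed
  then show ?thesis by simp
next
  case False
  then obtain v where "v \<in> weight_cone P \<inter> uminus ` weight_cone P" "v \<noteq> 0"
    unfolding pointed_def by blast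
  then have v: "v \<in> weight_cone P" "- v \<in> weight_cone P" "v \<noteq> 0" by auto
  have v0: "v \<bullet> \<alpha> = 0" if "\<alpha> \<in> P" for \<alpha>
    using v(1,2) that by (force simp: weight_cone_def)
  have "Phi P = 0"
  proof (rule ratfun_eqI)
    let ?H = "insert v weight_orbit" and ?U = "{x. \<forall>h\<in>insert v weight_orbit. x \<bullet> h \<noteq> 0}"
    show "open ?U" by (rule open_off_hyperplanes) (simp add: finite_weight_orbit)
    have "finite ?H" "0 \<notin> ?H" using finite_weight_orbit zero_notin_weight_orbit v(3) by auto
    then show "?U \<noteq> {}"
      using off_hyperplanes_nonempty[of ?H UNIV] by simp
    fix x assume x: "x \<in> ?U"
    have nz: "x \<bullet> act w (weight i) \<noteq> 0" if "w \<in> linear_extensions P" for w i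
      using x linear_extension_signed_perm[OF that] by (auto simp: weight_orbit_def)
    \<comment> \<open>The zero function is written as the indicator of the empty set to reuse
      \<open>set_lebesgue_integralI\<close>; the resulting integral is 0.\<close>
    have "AE u in lebesgue. signed_count P u x = indicator {} u"
      using AE_regular by eventually_elim (use v0 x in \<open>simp add: signed_count_eq_0_of_line[of v]\<close>)
    then have "(LINT u:{}|lebesgue. exp (- (x \<bullet> u)))
        = (\<Sum>w\<in>linear_extensions P. \<Prod>i\<in>UNIV. inverse (x \<bullet> act w (weight i)))"
      by (intro set_lebesgue_integralI(2)[OF Phi_sum_integral[OF nz]]) auto
    then have "has_value (Phi P) x 0"
      using has_value_Phi[of P, OF nz] by (simp add: set_lebesgue_integral_def)
    then show "\<exists>r. has_value (Phi P) x r \<and> has_value 0 x r"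
      using has_value_0 by blast
  qed
  then show ?thesis using False by (simp add: cone_integral_def)
qed

end

theorem mainTheorem5:
  fixes P :: "(real^'n::{finite,wellorder}) set"
  assumes "signed_poset P"
  shows "Psi P = cone_integral (root_cone P)
       \<and> Psi_dual (dual_poset P) = (1/2) * cone_integral (root_cone P)
       \<and> Phi P = cone_integral (weight_cone P)
       \<and> Phi_dual (dual_poset P) = 2 * cone_integral (weight_cone P)"
  using Psi_eq_cone_integral[OF assms] Phi_eq_cone_integral[OF assms]
    Psi_dual_eq[of P] Phi_dual_eq[of P] by simp

end
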